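(* Let $$F_1(z)={}_3F_2\!\left(\tfrac16,\tfrac12,\tfrac56;1,1;z\right),\qquad F_2(X)={}_3F_2\!\left(\tfrac14,\tfrac12,\tfrac34;1,1;X\right),$$ $$z(t)=\frac{1728t^2}{(t+256)^3},\qquad X(t)=\frac{256t}{(t+64)^2},\qquad \rho(t)^2=\frac{t+256}{t+64},$$ with the branch of $\rho$ chosen so that $\rho\to1$ as $t\to\infty$. Then, as germs of analytic functions at the cusp $t=\infty$, $$F_1(z(t))=\rho(t)F_2(X(t)).$$ The identity extends by analytic continuation of this germ to any simply connected region of the $t$-sphere containing $t=\infty$ and avoiding the singular values $t\in\{0,\,64,\,-64,\,-256,\,512\}$ of the pullbacks. In particular it holds on the real Fricke-cusp branch $t\in(-\infty,-512)$.
   Context: The functions $z(t)$ and $X(t)$ are holomorphic at $t=\infty$ and vanish there, so $F_1(z(t))$ and $F_2(X(t))$ are holomorphic germs at $t=\infty$ with value $1$. The singular values of the pullbacks are the singular points $t\neq\infty$ on the $t$-line of the hypergeometric differential equations pulled back by $z(t)$ and $X(t)$. On the real branch $t\in(-\infty,-512)$ one has $\rho(t)>0$. *)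

theory Defs
  imports "HOL-Complex_Analysis.Complex_Analysis"
begin

text \<open>Hypergeometric series. Outside the disc of convergence \<^const>\<open>eval_fps\<close> has no
  mathematical meaning; analytic continuations are named explicitly below.\<close>

definition F1 :: "complex \<Rightarrow> complex" where
  "F1 = eval_fps (fps_hypergeo [1/6, 1/2, 5/6] [1, 1] 1)"

definition F2 :: "complex \<Rightarrow> complex" where
  "F2 = eval_fps (fps_hypergeo [1/4, 1/2, 3/4] [1, 1] 1)"

definition zt :: "complex \<Rightarrow> complex" where
  "zt t = 1728 * t^2 / (t + 256)^3"

definition Xt :: "complex \<Rightarrow> complex" where
  "Xt t = 256 * t / (t + 64)^2"

text \<open>The \<open>t\<close>-sphere is the one-point compactification of the plane: \<^term>\<open>None\<close> is the point
  at infinity and \<^term>\<open>Some t\<close> the finite point \<open>t\<close>.\<close>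

definition sphere_top :: "complex option topology" where
  "sphere_top = Alexandroff_compactification euclidean"

definition chart_infinity :: "complex \<Rightarrow> complex option" where
  "chart_infinity w = (if w = 0 then None else Some (inverse w))"

text \<open>Intended for \<open>U\<close> open in \<^const>\<open>sphere_top\<close>; the two charts cover the sphere.\<close>

definition sphere_holomorphic_on :: "(complex option \<Rightarrow> complex) \<Rightarrow> complex option set \<Rightarrow> bool" where
  "sphere_holomorphic_on G U \<longleftrightarrow>
     (\<lambda>t. G (Some t)) holomorphic_on (Some -` U) \<and>
     (\<lambda>w. G (chart_infinity w)) holomorphic_on (chart_infinity -` U)"

text \<open>The analogue of \<^const>\<open>simply_connected\<close> for abstract topologies: any two loops are freely
  homotopic. Taking constant loops shows that it includes path connectedness.\<close>

definition simply_connected_space :: "'a topology \<Rightarrow> bool" where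
  "simply_connected_space T \<longleftrightarrow>
     (\<forall>p q. pathin T p \<and> p 1 = p 0 \<and> pathin T q \<and> q 1 = q 0
        \<longrightarrow> homotopic_with (\<lambda>r. r 1 = r 0) (top_of_set {0..1}) T p q)"

definition singular_values :: "complex set" where
  "singular_values = {0, 64, -64, -256, 512}"

definition admissible_region :: "complex option set \<Rightarrow> bool" where
  "admissible_region U \<longleftrightarrow>
     openin sphere_top U \<and> connectedin sphere_top U \<and>
     simply_connected_space (subtopology sphere_top U) \<and>
     None \<in> U \<and> U \<inter> Some ` singular_values = {}"

text \<open>\<open>G\<close> is an analytic function on \<open>U\<close> whose germ at infinity is that of \<open>g\<close>. Since
  holomorphy of \<open>G\<close> at \<^term>\<open>None\<close> forces the value there, it is enough to compare \<open>G\<close> and \<open>g\<close>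
  at the finite points near infinity.\<close>

definition continues_germ_at_infinity ::
  "(complex option \<Rightarrow> complex) \<Rightarrow> complex option set \<Rightarrow> (complex \<Rightarrow> complex) \<Rightarrow> bool" where
  "continues_germ_at_infinity G U g \<longleftrightarrow>
     sphere_holomorphic_on G U \<and> (\<forall>\<^sub>F t in at_infinity. G (Some t) = g t)"

definition analytic_germ_at_infinity :: "(complex \<Rightarrow> complex) \<Rightarrow> bool" where
  "analytic_germ_at_infinity g \<longleftrightarrow>
     (\<exists>V G. openin sphere_top V \<and> None \<in> V \<and> continues_germ_at_infinity G V g)"

text \<open>\<open>\<Phi>\<close> is the standard branch on the plane cut along \<open>[1,\<infinity>)\<close> of a germ \<open>f\<close> given on the unit disc.\<close>

definition principal_branch :: "(complex \<Rightarrow> complex) \<Rightarrow> (complex \<Rightarrow> complex) \<Rightarrow> bool" where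
  "principal_branch f \<Phi> \<longleftrightarrow>
     \<Phi> holomorphic_on (- (complex_of_real ` {1..})) \<and> (\<forall>z\<in>ball 0 1. \<Phi> z = f z)"

definition cusp_branch :: "real set" where
  "cusp_branch = {..<-512}"

end

theory Submission
  imports Defs
begin

text \<open>The proof works in the coordinate \<open>w = 1 / t\<close>. Because \<open>t = 0\<close> is a singular value, an admissible
  region of the sphere is the same thing as a simply connected open set \<open>V\<close> of the \<open>w\<close>-plane that
  contains \<open>0\<close> and avoids \<open>1/64, -1/64, -1/256, 1/512\<close>. Every statement about continuations thus
  becomes one about holomorphic functions on a plane domain.

  \<^bold>\<open>The identity of germs.\<close> Let \<open>\<theta> = w d/dw\<close>. The series \<open>f = \<^sub>3F\<^sub>2(a,b,c;1,1;\<cdot>)\<close>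
  and \<open>\<theta>f\<close>, \<open>\<theta>\<^sup>2f\<close> satisfy a first-order system, whose last equation expresses \<open>\<theta>\<^sup>3f\<close> through them with
  the factor \<open>z / (1 - z)\<close>. Pulling back along \<open>w \<mapsto> h(w)\<close> multiplies every right-hand side by
  \<open>\<gamma> = \<theta>h / h\<close>; this gives what is called a companion system below. Thus \<open>F\<^sub>1(z)\<close> solves the companion
  system of \<open>z\<close>. The arithmetic heart is that \<open>\<rho> F\<^sub>2(X)\<close> solves the same system: if
  \<open>Z\<^sub>0 = \<rho> F\<^sub>2(X)\<close> and \<open>Z\<^sub>1, Z\<^sub>2\<close> are forced by the first two equations, then the third one reduces to three
  identities between rational functions of \<open>w\<close> (\<open>gauge_identities\<close>, \<open>gauge_companion_germ\<close>).
  At \<open>w = 0\<close> the system has a regular singular point with nilpotent residue, so a holomorphic solution is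
  determined by the value of its first component there (\<open>companion_germ_unique\<close>), and both values
  are \<open>1\<close>. The underlying reason is modular: if \<open>t = (\<eta>(\<tau>) / \<eta>(2\<tau>))\<^bsup>24\<^esup>\<close>, then near the cusp
  \<open>z = 1728 / j(\<tau>)\<close>, \<open>F\<^sub>1(z)\<^sup>2 = E\<^sub>4(\<tau>)\<close> and \<open>F\<^sub>2(X) = 2 E\<^sub>2(2\<tau>) - E\<^sub>2(\<tau>)\<close>.

  \<^bold>\<open>Continuation.\<close> A Riemann map of \<open>V\<close> that fixes \<open>0\<close> turns the companion systems of \<open>z\<close> and of \<open>X\<close>
  into systems whose coefficients are holomorphic in the whole unit disc. The Taylor coefficients of a solution satisfy a recursion
  in which the \<open>n\<close>-th one carries the factor \<open>n\<close>, and this forces convergence in the whole disc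
  (\<open>fuchs_system_conv_radius\<close>). Transporting back, the germs of \<open>F\<^sub>1(z)\<close> and \<open>F\<^sub>2(X)\<close> at the cusp extend to all of \<open>V\<close>
  (\<open>hyp_pullback_continues\<close>). The same theorem for the plane slit along \<open>[1,\<infinity>)\<close> provides the
  principal branches. The function \<open>\<rho>\<close> continues as a holomorphic square root on \<open>V\<close>, and the identity
  theorem on \<open>V\<close> extends the identity of germs.

  \<^bold>\<open>The cusp branch.\<close> The half-line \<open>t < -512\<close> is the segment \<open>(-1/512, 0)\<close>. There \<open>z\<close> and \<open>X\<close> are negative and
  \<open>\<rho>\<^sup>2\<close> is positive, so the continuations agree near the segment with the principal branches and with the
  principal square root.\<close>

section \<open>Convergence of power series solutions at a regular singular point\<close>

text \<open>The sum on the right contains \<open>g 0 * a n\<close>, which is absorbed into the left side for large \<open>n\<close>. The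
  rest is at most \<open>(suminf g - g 0)\<close> times the largest earlier \<open>a k\<close>, so once \<open>n > suminf g\<close> no new
  maximum can occur. In the application \<open>a\<close> and \<open>g\<close> are coefficient norms weighted by \<open>r ^ n\<close>.\<close>

lemma bounded_of_causal_recursion:
  fixes a g :: "nat \<Rightarrow> real"
  assumes a: "\<And>n. 0 \<le> a n" and g: "\<And>n. 0 \<le> g n" and sg: "summable g"
    and rec: "\<And>n. real n * a n \<le> (\<Sum>k\<le>n. g (n - k) * a k)"
  shows "\<exists>K. \<forall>n. a n \<le> K"
proof -
  define B where "B = suminf g"
  define M where "M = nat \<lceil>B\<rceil> + 1"
  define K where "K = Max (a ` {..M})"
  have K0: "0 \<le> K"
    unfolding K_def by (rule order_trans[OF a[of 0]], rule Max_ge) auto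
  have "a n \<le> K" for n
  proof (induction n rule: less_induct)
    case (less n)
    show ?case
    proof (cases "n \<le> M")
      case True
      then show ?thesis by (auto simp: K_def intro!: Max_ge)
    next
      case False
      then have nB: "B < real n" unfolding M_def by linarith
      have part: "sum g {..n} \<le> B"
        unfolding B_def by (rule sum_le_suminf[OF sg]) (use g in auto)
      have "g 0 \<le> sum g {..n}"
        by (rule member_le_sum) (use g in auto)
      with part nB have pos: "0 < real n - g 0" by linarith
      have "(\<Sum>k<n. g (n - k) * a k) \<le> (\<Sum>k<n. g (n - k) * K)"
        by (intro sum_mono mult_left_mono less.IH g) auto
      also have "\<dots> = (\<Sum>k<n. g (Suc k)) * K"
        unfolding sum_distrib_right[symmetric]
        by (subst sum.nat_diff_reindex[symmetric]) (auto intro!: sum.cong arg_cong[where f = "\<lambda>x. x * K"] simp: Suc_diff_Suc)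
      also have "(\<Sum>k<n. g (Suc k)) = sum g {..n} - g 0"
        by (subst lessThan_Suc_atMost[symmetric], subst sum.lessThan_Suc_shift) simp
      finally have "real n * a n \<le> (sum g {..n} - g 0) * K + g 0 * a n"
        using rec[of n] by (simp add: lessThan_Suc_atMost[symmetric])
      also have "\<dots> \<le> (real n - g 0) * K + g 0 * a n"
        using part nB K0 by (intro add_right_mono mult_right_mono) auto
      finally have "(real n - g 0) * a n \<le> (real n - g 0) * K"
        by (simp add: algebra_simps)
      with pos show ?thesis by simp
    qed
  qed
  then show ?thesis by blast
qed

lemma fps_conv_radius_ge_of_bounded:
  fixes P :: "complex fps"
  assumes "\<And>r. 0 < r \<Longrightarrow> ereal r < R \<Longrightarrow> \<exists>K. \<forall>n. norm (fps_nth P n) * r ^ n \<le> K"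
  shows "R \<le> fps_conv_radius P"
  unfolding fps_conv_radius_def
proof (rule conv_radius_geI_ex')
  fix r :: real assume r: "0 < r" "ereal r < R"
  obtain s where s: "ereal r < ereal s" "ereal s < R"
    using ereal_dense2[OF r(2)] by auto
  then have rs: "r < s" "0 < s" using r by auto
  obtain K where K: "\<And>n. norm (fps_nth P n) * s ^ n \<le> K"
    using assms[OF rs(2) s(2)] by blast
  show "summable (\<lambda>n. fps_nth P n * of_real r ^ n)"
  proof (rule summable_comparison_test')
    show "summable (\<lambda>n. K * (r / s) ^ n)"
      using rs r by (intro summable_mult summable_geometric) auto
    fix n :: nat assume "0 \<le> n"
    have "norm (fps_nth P n * of_real r ^ n) = norm (fps_nth P n) * s ^ n * (r / s) ^ n"
      using rs r by (simp add: norm_mult norm_power power_divide)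
    also have "\<dots> \<le> K * (r / s) ^ n"
      using rs r by (intro mult_right_mono K) auto
    finally show "norm (fps_nth P n * of_real r ^ n) \<le> K * (r / s) ^ n" .
  qed
qed

text \<open>Fuchs: a formal solution of \<open>\<theta>P = N P\<close> converges wherever the coefficients \<open>N\<close> do. Comparing the
  coefficients of \<open>w\<^sup>n\<close> and summing norms over the components gives the recursion of
  \<open>bounded_of_causal_recursion\<close> for every radius \<open>r < R\<close>.\<close>

theorem fuchs_system_conv_radius:
  fixes P :: "'i \<Rightarrow> complex fps" and N :: "'i \<Rightarrow> 'i \<Rightarrow> complex fps"
  assumes I: "finite I"
    and N: "\<And>i j. i \<in> I \<Longrightarrow> j \<in> I \<Longrightarrow> R \<le> fps_conv_radius (N i j)"
    and sys: "\<And>i. i \<in> I \<Longrightarrow> fps_X * fps_deriv (P i) = (\<Sum>j\<in>I. N i j * P j)"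
    and i: "i \<in> I"
  shows "R \<le> fps_conv_radius (P i)"
proof (rule fps_conv_radius_ge_of_bounded)
  fix r :: real assume r: "0 < r" "ereal r < R"
  define a where "a n = (\<Sum>i\<in>I. norm (fps_nth (P i) n)) * r ^ n" for n
  define g where "g n = (\<Sum>i\<in>I. \<Sum>j\<in>I. norm (fps_nth (N i j) n)) * r ^ n" for n
  have "\<exists>K. \<forall>n. a n \<le> K"
  proof (rule bounded_of_causal_recursion)
    show "0 \<le> a n" "0 \<le> g n" for n
      using r by (auto simp: a_def g_def intro!: mult_nonneg_nonneg sum_nonneg)
    have "summable (\<lambda>n. norm (fps_nth (N i j) n) * r ^ n)" if "i \<in> I" "j \<in> I" for i j
    proof -
      have "ereal (norm (complex_of_real r)) < conv_radius (fps_nth (N i j))"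
        using N[OF that] r by (auto simp: fps_conv_radius_def)
      from abs_summable_in_conv_radius[OF this] show ?thesis
        using r by (simp add: norm_mult norm_power)
    qed
    then show "summable g"
      unfolding g_def sum_distrib_right by (intro summable_sum) auto
    fix n
    have coeff: "real n * norm (fps_nth (P i) n) \<le>
        (\<Sum>k\<le>n. \<Sum>j\<in>I. norm (fps_nth (N i j) (n - k)) * norm (fps_nth (P j) k))"
      if i: "i \<in> I" for i
    proof -
      have "of_nat n * fps_nth (P i) n = fps_nth (fps_X * fps_deriv (P i)) n"
        by (cases n) (auto simp: fps_X_mult_nth)
      also have "\<dots> = (\<Sum>j\<in>I. \<Sum>k=0..n. fps_nth (P j) k * fps_nth (N i j) (n - k))"
        unfolding sys[OF i] by (simp add: fps_sum_nth fps_mult_nth mult.commute[of "N i _"])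
      also have "\<dots> = (\<Sum>k\<le>n. \<Sum>j\<in>I. fps_nth (P j) k * fps_nth (N i j) (n - k))"
        by (subst sum.swap) (simp add: atLeast0AtMost)
      finally have "real n * norm (fps_nth (P i) n) =
          norm (\<Sum>k\<le>n. \<Sum>j\<in>I. fps_nth (P j) k * fps_nth (N i j) (n - k))"
        by (metis norm_mult norm_of_nat)
      also have "\<dots> \<le> (\<Sum>k\<le>n. \<Sum>j\<in>I. norm (fps_nth (N i j) (n - k)) * norm (fps_nth (P j) k))"
        by (intro sum_norm_le) (simp add: norm_mult mult.commute)
      finally show ?thesis .
    qed
    have "real n * a n = (\<Sum>i\<in>I. real n * norm (fps_nth (P i) n)) * r ^ n"
      by (simp add: a_def sum_distrib_left)
    also have "\<dots> \<le> (\<Sum>i\<in>I. \<Sum>k\<le>n. \<Sum>j\<in>I. norm (fps_nth (N i j) (n - k)) * norm (fps_nth (P j) k)) * r ^ n"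
      using r by (intro mult_right_mono sum_mono coeff) auto
    also have "\<dots> \<le> (\<Sum>i\<in>I. \<Sum>k\<le>n. (\<Sum>j\<in>I. norm (fps_nth (N i j) (n - k))) * (\<Sum>j\<in>I. norm (fps_nth (P j) k))) * r ^ n"
    proof (intro mult_right_mono sum_mono)
      fix i k
      have "(\<Sum>j\<in>I. norm (fps_nth (N i j) (n - k)) * norm (fps_nth (P j) k))
          \<le> (\<Sum>j\<in>I. norm (fps_nth (N i j) (n - k)) * (\<Sum>j\<in>I. norm (fps_nth (P j) k)))"
        using I by (intro sum_mono mult_left_mono member_le_sum) auto
      then show "(\<Sum>j\<in>I. norm (fps_nth (N i j) (n - k)) * norm (fps_nth (P j) k))
          \<le> (\<Sum>j\<in>I. norm (fps_nth (N i j) (n - k))) * (\<Sum>j\<in>I. norm (fps_nth (P j) k))"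
        by (simp add: sum_distrib_right)
    qed (use r in auto)
    also have "\<dots> = (\<Sum>k\<le>n. (\<Sum>i\<in>I. \<Sum>j\<in>I. norm (fps_nth (N i j) (n - k))) * (\<Sum>j\<in>I. norm (fps_nth (P j) k)) * r ^ n)"
      by (subst sum.swap) (simp only: sum_distrib_right)
    also have "\<dots> = (\<Sum>k\<le>n. g (n - k) * a k)"
    proof (rule sum.cong[OF refl])
      fix k assume "k \<in> {..n}"
      then have "r ^ n = r ^ (n - k) * r ^ k"
        by (simp flip: power_add)
      then show "(\<Sum>i\<in>I. \<Sum>j\<in>I. norm (fps_nth (N i j) (n - k))) * (\<Sum>j\<in>I. norm (fps_nth (P j) k)) * r ^ n
          = g (n - k) * a k"
        by (simp only: g_def a_def mult_ac)
    qed
    finally show "real n * a n \<le> (\<Sum>k\<le>n. g (n - k) * a k)" .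
  qed
  then obtain K where K: "\<And>n. a n \<le> K" by blast
  have "norm (fps_nth (P i) n) * r ^ n \<le> K" for n
  proof -
    have "norm (fps_nth (P i) n) \<le> (\<Sum>i\<in>I. norm (fps_nth (P i) n))"
      by (rule member_le_sum[OF i]) (use I in auto)
    then have "norm (fps_nth (P i) n) * r ^ n \<le> a n"
      using r by (auto simp: a_def intro!: mult_right_mono)
    with K[of n] show ?thesis by linarith
  qed
  then show "\<exists>K. \<forall>n. norm (fps_nth (P i) n) * r ^ n \<le> K" by blast
qed

text \<open>The operator \<open>\<theta> = w d/dw\<close> on formal power series.\<close>

definition euler :: "complex fps \<Rightarrow> complex fps" where
  "euler F = fps_X * fps_deriv F"

lemma euler_nth [simp]: "fps_nth (euler F) n = of_nat n * fps_nth F n"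
  unfolding euler_def by (cases n) (auto simp: fps_X_mult_nth)

text \<open>The shape in which all hypergeometric equations of this development appear: \<open>G\<close> is the logarithmic
  \<open>\<theta>\<close>-derivative of the pullback, and \<open>K\<close> is \<open>G\<close> times \<open>z / (1 - z)\<close>.\<close>

theorem companion_system_conv_radius:
  fixes G K P0 P1 P2 :: "complex fps"
  assumes G: "R \<le> fps_conv_radius G" and K: "R \<le> fps_conv_radius K"
    and sys: "euler P0 = G * P1" "euler P1 = G * P2"
      "euler P2 = K * (fps_const e1 * P2 + fps_const e2 * P1 + fps_const e3 * P0)"
  shows "R \<le> fps_conv_radius P0"
proof -
  define P where "P = (\<lambda>i::nat. if i = 0 then P0 else if i = 1 then P1 else P2)"
  define N where "N = (\<lambda>i j::nat. if i < 2 then if j = i + 1 then G else 0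
      else K * fps_const (if j = 0 then e3 else if j = 1 then e2 else e1))"
  have "R \<le> fps_conv_radius (P 0)"
  proof (rule fuchs_system_conv_radius[where I = "{..<3}" and N = N])
    fix i j :: nat
    have "R \<le> fps_conv_radius (K * fps_const c)" for c
      using fps_conv_radius_mult[of K "fps_const c"] K by auto
    then show "R \<le> fps_conv_radius (N i j)"
      using G by (auto simp: N_def)
  next
    fix i :: nat assume "i \<in> {..<3}"
    then consider "i = 0" | "i = 1" | "i = 2" by force
    then show "fps_X * fps_deriv (P i) = (\<Sum>j<3. N i j * P j)"
      using sys by cases (simp_all add: N_def P_def euler_def numeral_3_eq_3 algebra_simps)
  qed auto
  then show ?thesis by (simp add: P_def)
qed

text \<open>When \<open>G\<close> starts with \<open>1\<close> and \<open>K\<close> with \<open>0\<close>, the system at \<open>w = 0\<close> is a nilpotent Jordan block. If all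
  coefficients below \<open>n\<close> vanish, the \<open>n\<close>-th ones satisfy \<open>n P0 = P1\<close>, \<open>n P1 = P2\<close>, \<open>n P2 = 0\<close>: for
  \<open>n > 0\<close> they vanish, and for \<open>n = 0\<close> only the initial value of \<open>P0\<close> is free.\<close>

lemma companion_system_unique:
  fixes G K P0 P1 P2 :: "complex fps"
  assumes G: "fps_nth G 0 = 1" and K: "fps_nth K 0 = 0"
    and sys: "euler P0 = G * P1" "euler P1 = G * P2"
      "euler P2 = K * (fps_const e1 * P2 + fps_const e2 * P1 + fps_const e3 * P0)"
    and init: "fps_nth P0 0 = 0"
  shows "P0 = 0"
proof -
  have "fps_nth P0 n = 0 \<and> fps_nth P1 n = 0 \<and> fps_nth P2 n = 0" for n
  proof (induction n rule: less_induct)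
    case (less n)
    \<comment> \<open>Only the top coefficient of the second factor survives in a product.\<close>
    have top: "fps_nth (H * Q) n = fps_nth H 0 * fps_nth Q n"
      if "\<And>k. k < n \<Longrightarrow> fps_nth Q k = 0" for H Q :: "complex fps"
    proof -
      have "fps_nth (Q * H) n = (\<Sum>k\<in>{n}. fps_nth Q k * fps_nth H (n - k))"
        unfolding fps_mult_nth by (rule sum.mono_neutral_right) (auto simp: that)
      then show ?thesis by (simp add: mult.commute)
    qed
    have 0: "of_nat n * fps_nth P0 n = fps_nth P1 n"
      using arg_cong[OF sys(1), of "\<lambda>F. fps_nth F n"] less.IH by (simp add: top G)
    have 1: "of_nat n * fps_nth P1 n = fps_nth P2 n"
      using arg_cong[OF sys(2), of "\<lambda>F. fps_nth F n"] less.IH by (simp add: top G)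
    have 2: "of_nat n * fps_nth P2 n = 0"
      using arg_cong[OF sys(3), of "\<lambda>F. fps_nth F n"] less.IH by (simp add: top K)
    show ?case
      using 0 1 2 init by (cases "n = 0") auto
  qed
  then show ?thesis by (intro fps_ext) auto
qed

section \<open>The hypergeometric series and its differential equation\<close>

definition hyp :: "complex \<Rightarrow> complex \<Rightarrow> complex \<Rightarrow> complex fps" where
  "hyp a b c = fps_hypergeo [a, b, c] [1, 1] 1"

lemma F_hyp: "F1 = eval_fps (hyp (1/6) (1/2) (5/6))" "F2 = eval_fps (hyp (1/4) (1/2) (3/4))"
  by (simp_all add: F1_def F2_def hyp_def)

lemma hyp_nth_Suc:
  "of_nat (Suc n) ^ 3 * fps_nth (hyp a b c) (Suc n) =
     (of_nat n + a) * (of_nat n + b) * (of_nat n + c) * fps_nth (hyp a b c) n"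
proof -
  let ?x = "of_nat (Suc n) :: complex"
  have x: "?x \<noteq> 0" by (simp only: of_nat_eq_0_iff)
  have "fps_nth (hyp a b c) (Suc n) = (a + of_nat n) * (b + of_nat n) * (c + of_nat n) /
      (?x * ?x * ?x) * fps_nth (hyp a b c) n"
    unfolding hyp_def fps_hypergeo_rec by (simp del: fps_hypergeo_nth)
  with x show ?thesis
    by (simp add: power3_eq_cube add.commute del: of_nat_Suc)
qed

lemma euler_hyp:
  fixes a b c :: complex
  defines "F \<equiv> hyp a b c"
  shows "(1 - fps_X) * euler (euler (euler F)) =
    fps_X * (fps_const (a + b + c) * euler (euler F)
           + fps_const (a * b + b * c + c * a) * euler F + fps_const (a * b * c) * F)"
proof (rule fps_ext)
  fix n
  show "fps_nth ((1 - fps_X) * euler (euler (euler F))) n = fps_nth (fps_X *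
    (fps_const (a + b + c) * euler (euler F)
      + fps_const (a * b + b * c + c * a) * euler F + fps_const (a * b * c) * F)) n"
  proof (cases n)
    case (Suc m)
    from hyp_nth_Suc[of m a b c] show ?thesis
      unfolding Suc F_def by (simp add: left_diff_distrib fps_X_mult_nth algebra_simps power3_eq_cube)
  qed (simp add: left_diff_distrib)
qed

lemma fps_conv_radius_geometric: "1 \<le> fps_conv_radius (inverse (1 - fps_X :: complex fps))"
proof -
  have "(\<lambda>z::complex. inverse (1 - z)) has_fps_expansion inverse (1 - fps_X)"
    by (intro fps_expansion_intros) auto
  moreover have "(\<lambda>z::complex. inverse (1 - z)) holomorphic_on eball 0 1"
    by (intro holomorphic_intros) (auto simp: in_eball_iff)
  ultimately show ?thesis
    by (rule holomorphic_on_imp_fps_conv_radius_ge)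
qed

text \<open>The hypergeometric equation is itself a companion system, with \<open>G = 1\<close> and \<open>K = w / (1 - w)\<close>, so the
  radius of convergence follows from \<open>companion_system_conv_radius\<close> for arbitrary complex
  parameters.\<close>

lemma hyp_conv_radius: "1 \<le> fps_conv_radius (hyp a b c)"
proof -
  let ?F = "hyp a b c"
  let ?Q = "fps_const (a + b + c) * euler (euler ?F)
           + fps_const (a * b + b * c + c * a) * euler ?F + fps_const (a * b * c) * ?F"
  have "inverse (1 - fps_X) * (1 - fps_X) = (1 :: complex fps)"
    by (rule inverse_mult_eq_1) simp
  then have "euler (euler (euler ?F)) = inverse (1 - fps_X) * ((1 - fps_X) * euler (euler (euler ?F)))"
    by (simp add: mult.assoc[symmetric])
  also have "\<dots> = (fps_X * inverse (1 - fps_X)) * ?Q"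
    unfolding euler_hyp by (simp only: mult_ac)
  finally have sys: "euler (euler (euler ?F)) = (fps_X * inverse (1 - fps_X)) * ?Q" .
  show ?thesis
  proof (rule companion_system_conv_radius[OF _ _ _ _ sys])
    show "1 \<le> fps_conv_radius (1 :: complex fps)" by simp
    show "1 \<le> fps_conv_radius (fps_X * inverse (1 - fps_X) :: complex fps)"
      by (rule order_trans[OF _ fps_conv_radius_mult]) (simp add: fps_conv_radius_geometric)
  qed auto
qed

lemma euler_conv_radius: "fps_conv_radius F \<le> fps_conv_radius (euler F)"
  unfolding euler_def
  by (rule order_trans[OF _ fps_conv_radius_mult]) (simp add: fps_conv_radius_deriv)

lemma has_fps_expansion_euler:
  assumes "f has_fps_expansion F"
  shows "(\<lambda>z. z * deriv f z) has_fps_expansion euler F"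
  unfolding euler_def by (intro fps_expansion_intros assms)

lemma has_fps_expansion_unique_ev:
  fixes f g :: "complex \<Rightarrow> complex"
  assumes "f has_fps_expansion F" "g has_fps_expansion G" "\<forall>\<^sub>F z in nhds 0. f z = g z"
  shows "F = G"
  using assms has_fps_expansion_cong[OF assms(3) refl, of F] by (metis fps_expansion_eqI)


section \<open>Companion systems of germs\<close>

text \<open>Stating \<open>w f'(w) = d\<close> as a relation, instead of computing with \<^const>\<open>deriv\<close>, gives a calculus in which
  differentiability is carried along and no division by \<open>w\<close> occurs at \<open>w = 0\<close>.\<close>

definition theta_at :: "complex \<Rightarrow> (complex \<Rightarrow> complex) \<Rightarrow> complex \<Rightarrow> bool" where
  "theta_at w f d \<longleftrightarrow> (\<exists>D. (f has_field_derivative D) (at w) \<and> w * D = d)"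

lemma theta_const: "theta_at w (\<lambda>_. c) 0"
  unfolding theta_at_def by (auto intro!: exI[of _ 0] derivative_eq_intros)

lemma theta_id: "theta_at w (\<lambda>w. w) w"
  unfolding theta_at_def by (auto intro!: exI[of _ 1] derivative_eq_intros)

lemma theta_add: "theta_at w f d \<Longrightarrow> theta_at w g e \<Longrightarrow> theta_at w (\<lambda>w. f w + g w) (d + e)"
  unfolding theta_at_def by (auto intro!: derivative_eq_intros simp: ring_distribs)

lemma theta_diff: "theta_at w f d \<Longrightarrow> theta_at w g e \<Longrightarrow> theta_at w (\<lambda>w. f w - g w) (d - e)"
  unfolding theta_at_def by (auto intro!: derivative_eq_intros simp: ring_distribs)

lemma theta_mult:
  "theta_at w f d \<Longrightarrow> theta_at w g e \<Longrightarrow> theta_at w (\<lambda>w. f w * g w) (d * g w + f w * e)"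
  unfolding theta_at_def by (auto intro!: derivative_eq_intros simp: algebra_simps)

lemma theta_divide:
  "theta_at w f d \<Longrightarrow> theta_at w g e \<Longrightarrow> g w \<noteq> 0 \<Longrightarrow>
     theta_at w (\<lambda>w. f w / g w) ((d * g w - f w * e) / g w ^ 2)"
  unfolding theta_at_def by (auto intro!: derivative_eq_intros simp: algebra_simps power2_eq_square diff_divide_distrib)

lemma theta_power:
  "theta_at w f d \<Longrightarrow> theta_at w (\<lambda>w. f w ^ n) (of_nat n * f w ^ (n - 1) * d)"
  unfolding theta_at_def by (auto intro!: derivative_eq_intros simp: algebra_simps)

text \<open>The chain rule in logarithmic form: \<open>g\<close> plays the role of \<open>\<theta>k / k\<close>, but is given as a factor so that the
  rule also holds at zeros of \<open>k\<close>.\<close>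

lemma theta_compose:
  assumes "theta_at w k (g * k w)" "theta_at (k w) f d"
  shows "theta_at w (\<lambda>w. f (k w)) (g * d)"
proof -
  obtain D E where "(k has_field_derivative D) (at w)" "w * D = g * k w"
      "(f has_field_derivative E) (at (k w))" "k w * E = d"
    using assms unfolding theta_at_def by blast
  moreover from this have "w * (E * D) = g * d" by (metis mult.assoc mult.commute)
  ultimately show ?thesis
    unfolding theta_at_def using DERIV_chain2 by blast
qed

lemma theta_cong:
  assumes "theta_at w f d" "\<forall>\<^sub>F z in nhds w. f z = g z"
  shows "theta_at w g d"
  using assms DERIV_cong_ev[OF refl assms(2) refl] unfolding theta_at_def by simp

lemma theta_unique: "theta_at w f d \<Longrightarrow> theta_at w f e \<Longrightarrow> d = e"
  unfolding theta_at_def using DERIV_unique by blast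

lemma euler_fps_expansion:
  assumes f: "f analytic_on {0}" and ev: "\<forall>\<^sub>F w in nhds 0. theta_at w f (g w)"
    and g: "g has_fps_expansion G"
  shows "euler (fps_expansion f 0) = G"
proof (rule has_fps_expansion_unique_ev)
  show "(\<lambda>z. z * deriv f z) has_fps_expansion euler (fps_expansion f 0)"
    by (intro has_fps_expansion_euler analytic_at_imp_has_fps_expansion_0 f)
  show "\<forall>\<^sub>F z in nhds 0. z * deriv f z = g z"
    using ev by eventually_elim (auto simp: theta_at_def dest!: DERIV_imp_deriv)
qed (fact g)

text \<open>For the pullback of a hypergeometric system along \<open>h\<close>, the factor \<open>g\<close> is \<open>\<theta>h / h\<close>, the factor \<open>k\<close> is
  \<open>g * h / (1 - h)\<close>, and \<open>e1, e2, e3\<close> are the elementary symmetric functions of the upper parameters.\<close>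

definition companion_germ ::
  "(complex \<Rightarrow> complex) \<Rightarrow> (complex \<Rightarrow> complex) \<Rightarrow> complex \<Rightarrow> complex \<Rightarrow> complex \<Rightarrow>
   (complex \<Rightarrow> complex) \<Rightarrow> (complex \<Rightarrow> complex) \<Rightarrow> (complex \<Rightarrow> complex) \<Rightarrow> bool" where
  "companion_germ g k e1 e2 e3 Y0 Y1 Y2 \<longleftrightarrow>
     Y0 analytic_on {0} \<and> Y1 analytic_on {0} \<and> Y2 analytic_on {0} \<and>
     (\<forall>\<^sub>F w in nhds 0. theta_at w Y0 (g w * Y1 w) \<and> theta_at w Y1 (g w * Y2 w) \<and>
        theta_at w Y2 (k w * (e1 * Y2 w + e2 * Y1 w + e3 * Y0 w)))"

lemma companion_germ_fps:
  assumes "companion_germ g k e1 e2 e3 Y0 Y1 Y2" and g: "g has_fps_expansion G" and k: "k has_fps_expansion K"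
  shows "euler (fps_expansion Y0 0) = G * fps_expansion Y1 0"
    "euler (fps_expansion Y1 0) = G * fps_expansion Y2 0"
    "euler (fps_expansion Y2 0) =  K * (fps_const e1 * fps_expansion Y2 0
        + fps_const e2 * fps_expansion Y1 0 + fps_const e3 * fps_expansion Y0 0)"
proof -
  have an: "Y0 analytic_on {0}" "Y1 analytic_on {0}" "Y2 analytic_on {0}"
    and ev: "\<forall>\<^sub>F w in nhds 0. theta_at w Y0 (g w * Y1 w)" "\<forall>\<^sub>F w in nhds 0. theta_at w Y1 (g w * Y2 w)"
      "\<forall>\<^sub>F w in nhds 0. theta_at w Y2 (k w * (e1 * Y2 w + e2 * Y1 w + e3 * Y0 w))"
    using assms(1) by (auto simp: companion_germ_def eventually_conj_iff)
  note exps = an[THEN analytic_at_imp_has_fps_expansion_0]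
  show "euler (fps_expansion Y0 0) = G * fps_expansion Y1 0"
    by (rule euler_fps_expansion[OF an(1) ev(1)]) (intro fps_expansion_intros g exps)
  show "euler (fps_expansion Y1 0) = G * fps_expansion Y2 0"
    by (rule euler_fps_expansion[OF an(2) ev(2)]) (intro fps_expansion_intros g exps)
  show "euler (fps_expansion Y2 0) =  K * (fps_const e1 * fps_expansion Y2 0
        + fps_const e2 * fps_expansion Y1 0 + fps_const e3 * fps_expansion Y0 0)"
    by (rule euler_fps_expansion[OF an(3) ev(3)]) (intro fps_expansion_intros k exps)
qed

lemma has_fps_expansion_of_holomorphic_ball:
  assumes "g holomorphic_on ball 0 1"
  shows "g has_fps_expansion fps_expansion g 0" "1 \<le> fps_conv_radius (fps_expansion g 0)"
proof -
  show "g has_fps_expansion fps_expansion g 0"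
    using assms by (intro analytic_at_imp_has_fps_expansion_0) (auto simp: analytic_at intro!: exI[of _ "ball 0 1"])
  show "1 \<le> fps_conv_radius (fps_expansion g 0)"
    by (rule conv_radius_fps_expansion) (use assms in \<open>simp add: one_ereal_def\<close>)
qed

text \<open>A germ that solves the system is a power series; by Fuchs it converges in the disc in which the
  coefficient functions are holomorphic.\<close>

theorem companion_germ_continues_to_disc:
  assumes Y: "companion_germ g k e1 e2 e3 Y0 Y1 Y2"
    and g: "g holomorphic_on ball 0 1" and k: "k holomorphic_on ball 0 1"
  shows "\<exists>H. H holomorphic_on ball 0 1 \<and> (\<forall>\<^sub>F w in nhds 0. H w = Y0 w)"
proof -
  note G = has_fps_expansion_of_holomorphic_ball[OF g]
  note K = has_fps_expansion_of_holomorphic_ball[OF k]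
  have R: "1 \<le> fps_conv_radius (fps_expansion Y0 0)"
    by (rule companion_system_conv_radius[OF G(2) K(2) companion_germ_fps[OF Y G(1) K(1)]])
  have "Y0 has_fps_expansion fps_expansion Y0 0"
    using Y by (intro analytic_at_imp_has_fps_expansion_0) (simp add: companion_germ_def)
  moreover have "eval_fps (fps_expansion Y0 0) holomorphic_on ball 0 1"
    by (intro holomorphic_intros)
       (auto simp: in_eball_iff one_ereal_def intro!: less_le_trans[OF _ R])
  ultimately show ?thesis by (auto simp: has_fps_expansion_def)
qed

theorem companion_germ_unique:
  assumes Y: "companion_germ g k e1 e2 e3 Y0 Y1 Y2"
    and g: "g analytic_on {0}" "g 0 = 1" and k: "k analytic_on {0}" "k 0 = 0"
    and init: "Y0 0 = 0"
  shows "\<forall>\<^sub>F w in nhds 0. Y0 w = 0"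
proof -
  note G = analytic_at_imp_has_fps_expansion_0[OF g(1)]
  note K = analytic_at_imp_has_fps_expansion_0[OF k(1)]
  have "fps_expansion Y0 0 = 0"
    by (rule companion_system_unique[OF _ _ companion_germ_fps[OF Y G K]])
       (simp_all add: fps_expansion_def g k init)
  moreover have "Y0 has_fps_expansion fps_expansion Y0 0"
    using Y by (intro analytic_at_imp_has_fps_expansion_0) (simp add: companion_germ_def)
  ultimately show ?thesis by (simp add: has_fps_expansion_0_iff)
qed

lemma companion_germ_diff:
  assumes "companion_germ g k e1 e2 e3 Y0 Y1 Y2" "companion_germ g k e1 e2 e3 Z0 Z1 Z2"
  shows "companion_germ g k e1 e2 e3 (\<lambda>w. Y0 w - Z0 w) (\<lambda>w. Y1 w - Z1 w) (\<lambda>w. Y2 w - Z2 w)"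
  unfolding companion_germ_def
proof (intro conjI)
  have "\<forall>\<^sub>F w in nhds 0. theta_at w Y0 (g w * Y1 w) \<and> theta_at w Y1 (g w * Y2 w) \<and>
        theta_at w Y2 (k w * (e1 * Y2 w + e2 * Y1 w + e3 * Y0 w))"
    "\<forall>\<^sub>F w in nhds 0. theta_at w Z0 (g w * Z1 w) \<and> theta_at w Z1 (g w * Z2 w) \<and>
        theta_at w Z2 (k w * (e1 * Z2 w + e2 * Z1 w + e3 * Z0 w))"
    using assms by (auto simp: companion_germ_def)
  then show "\<forall>\<^sub>F w in nhds 0. theta_at w (\<lambda>w. Y0 w - Z0 w) (g w * (Y1 w - Z1 w)) \<and>
      theta_at w (\<lambda>w. Y1 w - Z1 w) (g w * (Y2 w - Z2 w)) \<and>
      theta_at w (\<lambda>w. Y2 w - Z2 w)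
        (k w * (e1 * (Y2 w - Z2 w) + e2 * (Y1 w - Z1 w) + e3 * (Y0 w - Z0 w)))"
  proof eventually_elim
    case (elim w)
    then have "theta_at w (\<lambda>w. Y0 w - Z0 w) (g w * Y1 w - g w * Z1 w)"
      "theta_at w (\<lambda>w. Y1 w - Z1 w) (g w * Y2 w - g w * Z2 w)"
      "theta_at w (\<lambda>w. Y2 w - Z2 w) (k w * (e1 * Y2 w + e2 * Y1 w + e3 * Y0 w) -
           k w * (e1 * Z2 w + e2 * Z1 w + e3 * Z0 w))"
      by (auto intro: theta_diff)
    then show ?case by (simp add: algebra_simps)
  qed
qed (use assms in \<open>auto simp: companion_germ_def intro!: analytic_intros\<close>)

lemma theta_eval_fps:
  assumes "norm z < fps_conv_radius F"
  shows "theta_at z (eval_fps F) (eval_fps (euler F) z)"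
proof -
  have "(eval_fps F has_field_derivative eval_fps (fps_deriv F) z) (at z)"
    using assms by (auto intro!: derivative_eq_intros simp: in_eball_iff)
  moreover have "norm z < fps_conv_radius (fps_deriv F)"
    using assms fps_conv_radius_deriv[of F] by (rule less_le_trans)
  then have "z * eval_fps (fps_deriv F) z = eval_fps (euler F) z"
    by (simp add: euler_def eval_fps_mult)
  ultimately show ?thesis by (auto simp: theta_at_def)
qed

lemma theta_hyp:
  fixes a b c :: complex
  defines "F \<equiv> hyp a b c"
  assumes z: "norm z < 1"
  shows "theta_at z (eval_fps F) (eval_fps (euler F) z)"
    "theta_at z (eval_fps (euler F)) (eval_fps (euler (euler F)) z)"
    "theta_at z (eval_fps (euler (euler F))) (z / (1 - z) * ((a + b + c) * eval_fps (euler (euler F)) z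
       + (a * b + b * c + c * a) * eval_fps (euler F) z + a * b * c * eval_fps F z))"
proof -
  have R0: "1 \<le> fps_conv_radius F" unfolding F_def by (rule hyp_conv_radius)
  have R1: "1 \<le> fps_conv_radius (euler F)" using R0 euler_conv_radius order_trans by blast
  have R2: "1 \<le> fps_conv_radius (euler (euler F))" using R1 euler_conv_radius order_trans by blast
  have R3: "1 \<le> fps_conv_radius (euler (euler (euler F)))" using R2 euler_conv_radius order_trans by blast
  have z: "ereal (norm z) < 1" using z by simp
  note r = less_le_trans[OF z R0] less_le_trans[OF z R1] less_le_trans[OF z R2] less_le_trans[OF z R3]
  show "theta_at z (eval_fps F) (eval_fps (euler F) z)"
    "theta_at z (eval_fps (euler F)) (eval_fps (euler (euler F)) z)"
    by (intro theta_eval_fps r)+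
  have cr: "ereal (norm z) < fps_conv_radius (fps_const d * G)" "ereal (norm z) < fps_conv_radius (G + G')"
    if "ereal (norm z) < fps_conv_radius G" "ereal (norm z) < fps_conv_radius G'" for d and G G' :: "complex fps"
    using that fps_conv_radius_mult[of "fps_const d" G]
    by (auto intro: less_le_trans[OF _ fps_conv_radius_add] less_le_trans)
  have "eval_fps ((1 - fps_X) * euler (euler (euler F))) z = (1 - z) * eval_fps (euler (euler (euler F))) z"
    using r by (subst eval_fps_mult) (auto simp: eval_fps_diff intro!: less_le_trans[OF _ fps_conv_radius_diff])
  moreover have "eval_fps (fps_X * (fps_const (a + b + c) * euler (euler F)
           + fps_const (a * b + b * c + c * a) * euler F + fps_const (a * b * c) * F)) z =
       z * ((a + b + c) * eval_fps (euler (euler F)) z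
       + (a * b + b * c + c * a) * eval_fps (euler F) z + a * b * c * eval_fps F z)"
    using r by (simp add: eval_fps_mult eval_fps_add cr)
  ultimately have "(1 - z) * eval_fps (euler (euler (euler F))) z = z * ((a + b + c) * eval_fps (euler (euler F)) z
       + (a * b + b * c + c * a) * eval_fps (euler F) z + a * b * c * eval_fps F z)"
    using euler_hyp[of a b c] unfolding F_def by simp
  moreover have "1 - z \<noteq> 0" using z by auto
  ultimately have "eval_fps (euler (euler (euler F))) z = z / (1 - z) * ((a + b + c) * eval_fps (euler (euler F)) z
       + (a * b + b * c + c * a) * eval_fps (euler F) z + a * b * c * eval_fps F z)"
    by (simp add: divide_simps mult_ac)
  then show "theta_at z (eval_fps (euler (euler F))) (z / (1 - z) * ((a + b + c) * eval_fps (euler (euler F)) z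
       + (a * b + b * c + c * a) * eval_fps (euler F) z + a * b * c * eval_fps F z))"
    using theta_eval_fps[OF r(3)] by simp
qed

text \<open>By the logarithmic chain rule, the pullback of the hypergeometric system along \<open>h\<close> only picks up
  the factor \<open>g = \<theta>h / h\<close>.\<close>

lemma hyp_pullback_companion_germ:
  fixes a b c :: complex and h g :: "complex \<Rightarrow> complex"
  defines "F \<equiv> hyp a b c"
  assumes h: "h analytic_on {0}" "h 0 = 0"
    and gh: "\<forall>\<^sub>F w in nhds 0. theta_at w h (g w * h w)"
  shows "companion_germ g (\<lambda>w. g w * (h w / (1 - h w))) (a + b + c) (a * b + b * c + c * a) (a * b * c)
     (\<lambda>w. eval_fps F (h w)) (\<lambda>w. eval_fps (euler F) (h w)) (\<lambda>w. eval_fps (euler (euler F)) (h w))"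
  unfolding companion_germ_def
proof (intro conjI)
  have R0: "1 \<le> fps_conv_radius F" unfolding F_def by (rule hyp_conv_radius)
  have R1: "1 \<le> fps_conv_radius (euler F)" using R0 euler_conv_radius order_trans by blast
  have R2: "1 \<le> fps_conv_radius (euler (euler F))" using R1 euler_conv_radius order_trans by blast
  have "(\<lambda>w. eval_fps G (h w)) analytic_on {0}" if "1 \<le> fps_conv_radius G" for G
  proof -
    have "0 < fps_conv_radius G"
      using that by (rule less_le_trans[rotated]) simp
    then have "eval_fps G analytic_on {h 0}"
      by (intro analytic_intros) (auto simp: h(2) in_eball_iff zero_ereal_def)
    with h(1) show ?thesis
      using analytic_on_compose[OF h(1), of "eval_fps G"] by (simp add: o_def)
  qed
  with R0 R1 R2 show "(\<lambda>w. eval_fps F (h w)) analytic_on {0}"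
    "(\<lambda>w. eval_fps (euler F) (h w)) analytic_on {0}"
    "(\<lambda>w. eval_fps (euler (euler F)) (h w)) analytic_on {0}" by auto
  have "isCont h 0" using h(1) by (rule analytic_at_imp_isCont)
  then have "\<forall>\<^sub>F w in nhds 0. h w \<in> ball 0 1"
    using h(2) by (intro eventually_compose_filterlim[OF eventually_nhds_in_open[of "ball 0 1" "0::complex"]])
       (auto simp: isCont_def tendsto_nhds_iff continuous_at_imp_continuous_within)
  with gh show "\<forall>\<^sub>F w in nhds 0.
      theta_at w (\<lambda>w. eval_fps F (h w)) (g w * eval_fps (euler F) (h w)) \<and>
      theta_at w (\<lambda>w. eval_fps (euler F) (h w)) (g w * eval_fps (euler (euler F)) (h w)) \<and>
      theta_at w (\<lambda>w. eval_fps (euler (euler F)) (h w)) (g w * (h w / (1 - h w)) *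
        ((a + b + c) * eval_fps (euler (euler F)) (h w) + (a * b + b * c + c * a) * eval_fps (euler F) (h w)
          + a * b * c * eval_fps F (h w)))"
  proof eventually_elim
    case (elim w)
    then have n: "norm (h w) < 1" by simp
    note th = theta_hyp[OF n, of a b c, folded F_def, THEN theta_compose[OF elim(1)]]
    from th show ?case by (simp only: mult.assoc simp_thms)
  qed
qed

section \<open>Continuation of hypergeometric pullbacks to simply connected domains\<close>

lemma riemann_map_centred:
  assumes "open V" "simply_connected V" "V \<noteq> UNIV" "0 \<in> V"
  obtains \<phi> \<psi> where "\<phi> holomorphic_on ball 0 1" "\<psi> holomorphic_on V" "\<phi> 0 = 0"
    "\<And>u. u \<in> ball 0 1 \<Longrightarrow> \<phi> u \<in> V \<and> \<psi> (\<phi> u) = u" "\<And>w. w \<in> V \<Longrightarrow> \<psi> w \<in> ball 0 1 \<and> \<phi> (\<psi> w) = w"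
proof -
  have "open V \<and> simply_connected V" using assms by simp
  then obtain f g where f: "f holomorphic_on V" and g: "g holomorphic_on ball 0 1"
    and fg: "\<And>w. w \<in> V \<Longrightarrow> f w \<in> ball 0 1 \<and> g (f w) = w"
      "\<And>u. u \<in> ball 0 1 \<Longrightarrow> g u \<in> V \<and> f (g u) = u"
    unfolding Riemann_mapping_theorem using assms(3,4) by blast
  have "f 0 \<in> ball 0 1" using fg(1) assms(4) by blast
  then obtain m n where m: "m (f 0) = 0" "m holomorphic_on ball 0 1" "m ` ball 0 1 \<subseteq> ball 0 1"
    and n: "n holomorphic_on ball 0 1" "n ` ball 0 1 \<subseteq> ball 0 1"
    and mn: "\<And>u. u \<in> ball 0 1 \<Longrightarrow> m (n u) = u" "\<And>u. u \<in> ball 0 1 \<Longrightarrow> n (m u) = u"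
    by (metis ball_biholomorphism_exists)
  show thesis
  proof
    show "(g \<circ> n) holomorphic_on ball 0 1"
      by (rule holomorphic_on_compose_gen[OF n(1) g n(2)])
    show "(m \<circ> f) holomorphic_on V"
      by (rule holomorphic_on_compose_gen[OF f m(2)]) (use fg in blast)
    show "(g \<circ> n) 0 = 0"
      using mn(2)[of "f 0"] m(1) fg(1)[OF assms(4)] by simp
  qed (use fg m n mn in \<open>auto simp: image_subset_iff\<close>)
qed

lemma theta_of_holomorphic:
  assumes "f holomorphic_on S" "open S" "w \<in> S"
  shows "theta_at w f (w * deriv f w)"
  using holomorphic_derivI[OF assms] by (auto simp: theta_at_def)

text \<open>Along a Riemann map \<open>\<phi>\<close> with \<open>\<phi> 0 = 0\<close> the pullback \<open>h\<close> becomes \<open>h \<circ> \<phi>\<close> on the unit disc, with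
  logarithmic derivative \<open>\<beta> * (g \<circ> \<phi>)\<close> where \<open>\<beta> = \<theta>\<phi> / \<phi>\<close>. As \<open>\<phi>\<close> is injective, its zero at \<open>0\<close> is
  simple and it has no other zero, so \<open>\<beta>\<close> is holomorphic in the whole disc. The values \<open>h w \<noteq> 1\<close> keep
  the remaining coefficient holomorphic.\<close>

theorem hyp_pullback_continues:
  assumes V: "open V" "simply_connected V" "V \<noteq> UNIV" "0 \<in> V"
    and h: "h holomorphic_on V" "h 0 = 0" "\<And>w. w \<in> V \<Longrightarrow> h w \<noteq> 1"
    and g: "g holomorphic_on V" "\<And>w. w \<in> V \<Longrightarrow> theta_at w h (g w * h w)"
  shows "\<exists>H. H holomorphic_on V \<and> (\<forall>\<^sub>F w in nhds 0. H w = eval_fps (hyp a b c) (h w))"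
proof -
  obtain \<phi> \<psi> where \<phi>: "\<phi> holomorphic_on ball 0 1" "\<phi> 0 = 0"
    and \<psi>: "\<psi> holomorphic_on V"
    and inv: "\<And>u. u \<in> ball 0 1 \<Longrightarrow> \<phi> u \<in> V \<and> \<psi> (\<phi> u) = u"
      "\<And>w. w \<in> V \<Longrightarrow> \<psi> w \<in> ball 0 1 \<and> \<phi> (\<psi> w) = w"
    using riemann_map_centred[OF V] by metis
  \<comment> \<open>\<open>\<phi> u = u * \<xi> u\<close>, with the removable singularity at \<open>0\<close> filled in.\<close>
  define \<xi> where "\<xi> u = (if u = 0 then deriv \<phi> 0 else \<phi> u / u)" for u
  have \<xi>: "\<xi> holomorphic_on ball 0 1"
    by (rule pole_theorem_open_0[where g = \<phi> and a = 0]) (use \<phi> in \<open>auto simp: \<xi>_def\<close>)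
  have inj: "inj_on \<phi> (ball 0 1)"
    by (rule inj_on_inverseI[where g = \<psi>]) (use inv in blast)
  have "deriv \<phi> 0 \<noteq> 0"
    by (rule holomorphic_injective_imp_regular[OF \<phi>(1) _ inj]) auto
  moreover have "\<phi> u \<noteq> 0" if "u \<in> ball 0 1" "u \<noteq> 0" for u
    using inj_onD[OF inj, of u 0] that \<phi>(2) by auto
  ultimately have \<xi>0: "\<xi> u \<noteq> 0" if "u \<in> ball 0 1" for u
    using that by (auto simp: \<xi>_def)
  define \<beta> where "\<beta> u = deriv \<phi> u / \<xi> u" for u
  have \<beta>: "\<beta> holomorphic_on ball 0 1"
    unfolding \<beta>_def using \<xi>0 by (intro holomorphic_intros \<phi> \<xi>) auto
  have \<phi>\<beta>: "theta_at u \<phi> (\<beta> u * \<phi> u)" if u: "u \<in> ball 0 1" for u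
  proof -
    have "\<phi> u = u * \<xi> u" using \<phi>(2) by (simp add: \<xi>_def)
    then have "\<beta> u * \<phi> u = u * deriv \<phi> u" using \<xi>0[OF u] by (simp add: \<beta>_def)
    then show ?thesis using theta_of_holomorphic[OF \<phi>(1) _ u] by simp
  qed
  have \<phi>V: "\<phi> ` ball 0 1 \<subseteq> V" using inv by blast
  define k where "k = (\<lambda>u. h (\<phi> u))"
  define d where "d = (\<lambda>u. \<beta> u * g (\<phi> u))"
  have k: "k holomorphic_on ball 0 1" and g\<phi>: "(\<lambda>u. g (\<phi> u)) holomorphic_on ball 0 1"
    using holomorphic_on_compose_gen[OF \<phi>(1) h(1) \<phi>V] holomorphic_on_compose_gen[OF \<phi>(1) g(1) \<phi>V]
    by (simp_all add: k_def o_def)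
  have d: "d holomorphic_on ball 0 1"
    unfolding d_def by (intro holomorphic_intros \<beta> g\<phi>)
  have k1: "k u \<noteq> 1" if "u \<in> ball 0 1" for u
    using that h(3) inv(1) by (auto simp: k_def)
  have kd: "(\<lambda>u. d u * (k u / (1 - k u))) holomorphic_on ball 0 1"
    by (intro holomorphic_intros d k) (use k1 in force)
  have "\<forall>\<^sub>F u in nhds 0. u \<in> ball (0::complex) 1"
    by (intro eventually_nhds_in_open) auto
  then have "\<forall>\<^sub>F u in nhds 0. theta_at u k (d u * k u)"
  proof eventually_elim
    case (elim u)
    have "theta_at u k (\<beta> u * (g (\<phi> u) * h (\<phi> u)))"
      unfolding k_def by (rule theta_compose[OF \<phi>\<beta>[OF elim] g(2)]) (use inv(1) elim in blast)
    then show ?case by (simp add: d_def k_def mult_ac)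
  qed
  moreover have "k analytic_on {0}"
    using k by (auto simp: analytic_at intro!: exI[of _ "ball 0 1"])
  moreover have "k 0 = 0" by (simp add: k_def \<phi> h)
  ultimately obtain H where H: "H holomorphic_on ball 0 1" "\<forall>\<^sub>F u in nhds 0. H u = eval_fps (hyp a b c) (k u)"
    using companion_germ_continues_to_disc[OF hyp_pullback_companion_germ d kd] by blast
  show ?thesis
  proof (intro exI conjI)
    show "(\<lambda>w. H (\<psi> w)) holomorphic_on V"
      using holomorphic_on_compose_gen[OF \<psi> H(1)] inv(2) by (auto simp: o_def image_subset_iff)
    have "\<psi> 0 = 0" using inv(1)[of 0] \<phi>(2) by simp
    moreover have "isCont \<psi> 0"
      using \<psi> V holomorphic_on_imp_continuous_on continuous_on_eq_continuous_at by blast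
    ultimately have "\<forall>\<^sub>F w in nhds 0. H (\<psi> w) = eval_fps (hyp a b c) (k (\<psi> w))"
      by (intro eventually_compose_filterlim[OF H(2)])
         (auto simp: isCont_def tendsto_nhds_iff)
    moreover have "\<forall>\<^sub>F w in nhds 0. w \<in> V"
      using V by (intro eventually_nhds_in_open)
    ultimately show "\<forall>\<^sub>F w in nhds 0. H (\<psi> w) = eval_fps (hyp a b c) (h w)"
      by eventually_elim (use inv(2) in \<open>auto simp: k_def\<close>)
  qed
qed

section \<open>The identity of germs\<close>

text \<open>The pullbacks \<open>z\<close> and \<open>X\<close> in the coordinate \<open>w = 1 / t\<close>, with their logarithmic \<open>\<theta>\<close>-derivatives.\<close>

definition zw :: "complex \<Rightarrow> complex" where "zw w = 1728 * w / (1 + 256 * w) ^ 3"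
definition Xw :: "complex \<Rightarrow> complex" where "Xw w = 256 * w / (1 + 64 * w) ^ 2"
definition zw_dlog :: "complex \<Rightarrow> complex" where "zw_dlog w = (1 - 512 * w) / (1 + 256 * w)"
definition Xw_dlog :: "complex \<Rightarrow> complex" where "Xw_dlog w = (1 - 64 * w) / (1 + 64 * w)"

lemma theta_linear: "theta_at w (\<lambda>w. 1 + c * w) (c * w)"
  unfolding theta_at_def by (auto intro!: exI[of _ c] derivative_eq_intros)

lemma theta_linear_minus: "theta_at w (\<lambda>w. 1 - c * w) (- c * w)"
  unfolding theta_at_def by (auto intro!: exI[of _ "- c"] derivative_eq_intros)

lemma theta_zw:
  assumes "1 + 256 * w \<noteq> 0"
  shows "theta_at w zw (zw_dlog w * zw w)"
proof -
  define p where "p = 1 + 256 * w"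
  have "theta_at w zw (((0 * w + 1728 * w) * p ^ 3 - 1728 * w * (of_nat 3 * p ^ (3 - 1) * (256 * w))) / (p ^ 3) ^ 2)"
    unfolding zw_def p_def
    by (intro theta_divide theta_mult theta_const theta_id theta_power theta_linear) (use assms in auto)
  also have "((0 * w + 1728 * w) * p ^ 3 - 1728 * w * (of_nat 3 * p ^ (3 - 1) * (256 * w))) / (p ^ 3) ^ 2
     = (p - 768 * w) / p * (1728 * w / p ^ 3)"
    using assms[folded p_def] by (simp add: divide_simps) algebra
  also have "\<dots> = zw_dlog w * zw w"
    by (simp add: zw_dlog_def zw_def p_def)
  finally show ?thesis .
qed

lemma theta_Xw:
  assumes "1 + 64 * w \<noteq> 0"
  shows "theta_at w Xw (Xw_dlog w * Xw w)"
proof -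
  define q where "q = 1 + 64 * w"
  have "theta_at w Xw (((0 * w + 256 * w) * q ^ 2 - 256 * w * (of_nat 2 * q ^ (2 - 1) * (64 * w))) / (q ^ 2) ^ 2)"
    unfolding Xw_def q_def
    by (intro theta_divide theta_mult theta_const theta_id theta_power theta_linear) (use assms in auto)
  also have "((0 * w + 256 * w) * q ^ 2 - 256 * w * (of_nat 2 * q ^ (2 - 1) * (64 * w))) / (q ^ 2) ^ 2
     = (q - 128 * w) / q * (256 * w / q ^ 2)"
    using assms[folded q_def] by (simp add: divide_simps) algebra
  also have "\<dots> = Xw_dlog w * Xw w"
    by (simp add: Xw_dlog_def Xw_def q_def)
  finally show ?thesis .
qed

lemma one_minus_zw:
  assumes "1 + 256 * w \<noteq> 0"
  shows "1 - zw w = (1 - 512 * w) ^ 2 * (1 + 64 * w) / (1 + 256 * w) ^ 3"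
  using assms unfolding zw_def by (simp add: divide_simps) algebra

lemma one_minus_Xw:
  assumes "1 + 64 * w \<noteq> 0"
  shows "1 - Xw w = (1 - 64 * w) ^ 2 / (1 + 64 * w) ^ 2"
  using assms unfolding Xw_def by (simp add: divide_simps) algebra

text \<open>At \<open>w = 1/512\<close> the function \<open>1 - z\<close> has a double zero; the simple zero of \<^const>\<open>zw_dlog\<close> there lowers
  the order of the pole from two to one.\<close>

lemma zw_last_row_factor:
  assumes "1 + 256 * w \<noteq> 0" "1 + 64 * w \<noteq> 0" "1 - 512 * w \<noteq> 0"
  shows "zw_dlog w * (zw w / (1 - zw w)) = 1728 * w / ((1 + 256 * w) * (1 + 64 * w) * (1 - 512 * w))"
proof -
  define p q r where "p = 1 + 256 * w" and "q = 1 + 64 * w" and "r = 1 - 512 * w"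
  have "r / p * (1728 * w / p ^ 3 / (r ^ 2 * q / p ^ 3)) = 1728 * w / (p * q * r)"
    using assms[folded p_def q_def r_def] by (simp add: divide_simps power2_eq_square)
  then show ?thesis
    unfolding one_minus_zw[OF assms(1)] unfolding zw_dlog_def zw_def p_def q_def r_def .
qed

lemma Xw_last_row_factor:
  assumes "1 + 64 * w \<noteq> 0" "1 - 64 * w \<noteq> 0"
  shows "Xw_dlog w * (Xw w / (1 - Xw w)) = 256 * w / ((1 + 64 * w) * (1 - 64 * w))"
proof -
  define q s where "q = 1 + 64 * w" and "s = 1 - 64 * w"
  have "s / q * (256 * w / q ^ 2 / (s ^ 2 / q ^ 2)) = 256 * w / (q * s)"
    using assms[folded q_def s_def] by (simp add: divide_simps power2_eq_square)
  then show ?thesis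
    unfolding one_minus_Xw[OF assms(1)] unfolding Xw_dlog_def Xw_def q_def s_def .
qed

text \<open>The logarithmic \<open>\<theta>\<close>-derivative of a square root is rational and independent of the branch.\<close>

lemma theta_rho:
  assumes R: "R analytic_on {w}" and R2: "\<forall>\<^sub>F w in nhds w. R w ^ 2 = (1 + 256 * w) / (1 + 64 * w)"
    and nz: "1 + 256 * w \<noteq> 0" "1 + 64 * w \<noteq> 0"
  shows "theta_at w R (96 * w / ((1 + 256 * w) * (1 + 64 * w)) * R w)"
proof -
  define p q where "p = 1 + 256 * w" and "q = 1 + 64 * w"
  obtain D where D: "(R has_field_derivative D) (at w)"
    using R analytic_on_imp_differentiable_at[of R "{w}" w] by (auto simp: field_differentiable_def)
  have th: "theta_at w R (w * D)" using D by (auto simp: theta_at_def)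
  have "theta_at w (\<lambda>w. (1 + 256 * w) / (1 + 64 * w)) ((256 * w * q - p * (64 * w)) / q ^ 2)"
    unfolding p_def q_def using nz by (intro theta_divide theta_linear)
  moreover have "theta_at w (\<lambda>w. (1 + 256 * w) / (1 + 64 * w)) (of_nat 2 * R w ^ (2 - 1) * (w * D))"
    by (rule theta_cong[OF theta_power[OF th] R2])
  ultimately have e: "2 * R w * (w * D) = (256 * w * q - p * (64 * w)) / q ^ 2"
    using theta_unique by fastforce
  have Rw: "R w ^ 2 = p / q" using eventually_nhds_x_imp_x[OF R2] by (simp add: p_def q_def)
  have nz': "p \<noteq> 0" "q \<noteq> 0" using nz by (auto simp: p_def q_def)
  have "R w \<noteq> 0" using Rw nz' by auto
  have "2 * R w ^ 2 * (w * D) = R w * (2 * R w * (w * D))"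
    by (simp add: power2_eq_square)
  also note e
  finally have "2 * R w ^ 2 * (w * D) = R w * ((256 * w * q - p * (64 * w)) / q ^ 2)" .
  then have "2 * (p / q) * (w * D) = R w * ((256 * w * q - p * (64 * w)) / q ^ 2)"
    unfolding Rw .
  also have "256 * w * q - p * (64 * w) = 192 * w"
    unfolding p_def q_def by algebra
  finally have "w * D = 96 * w / (p * q) * R w"
    using nz' by (simp add: field_simps power2_eq_square)
  with th show ?thesis by (simp add: p_def q_def)
qed

text \<open>Let \<open>B\<^sub>0 = F\<^sub>2(X)\<close>, \<open>B\<^sub>1\<close>, \<open>B\<^sub>2\<close> be the solution of the companion system of \<open>X\<close>. For
  \<open>Z\<^sub>0 = \<rho> B\<^sub>0\<close> the first two equations of the companion system of \<open>z\<close> force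
  \<open>Z\<^sub>1 = \<theta>Z\<^sub>0 / \<gamma>\<close> and \<open>Z\<^sub>2 = \<theta>Z\<^sub>1 / \<gamma>\<close> with \<open>\<gamma> = \<theta>z / z\<close>. Expanding these in the \<open>B\<^sub>i\<close> gives
  \<open>\<rho>\<close> times rational functions of \<open>w\<close>. The polynomials \<open>gauge0, gauge1, gauge2\<close> are the numerators of the
  coefficients of \<open>B\<^sub>0, B\<^sub>1, B\<^sub>2\<close> in \<open>Z\<^sub>2\<close> over the common denominator \<open>(1 + 64 w)\<^sup>2 (1 - 512 w)\<^sup>3\<close>.\<close>

definition gauge0 :: "complex \<Rightarrow> complex" where
  "gauge0 w = 96 * w * (1 + 352 * w - 16384 * w^2 + 8388608 * w^3)"
definition gauge1 :: "complex \<Rightarrow> complex" where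
  "gauge1 w = w * (1 + 256 * w) * (832 - 77824 * w + 19922944 * w^2)"
definition gauge2 :: "complex \<Rightarrow> complex" where
  "gauge2 w = (1 + 256 * w)^2 * (1 - 512 * w) * (1 - 64 * w)^2"

text \<open>The \<open>\<theta>\<close>-derivatives of the three numerators.\<close>

definition theta_gauge0 :: "complex \<Rightarrow> complex" where
  "theta_gauge0 w = 96 * (w + 704 * w^2 - 49152 * w^3 + 33554432 * w^4)"
definition theta_gauge1 :: "complex \<Rightarrow> complex" where
  "theta_gauge1 w = 256 * w * w * (832 - 77824 * w + 19922944 * w^2)
     + (1 + 256 * w) * (832 * w - 155648 * w^2 + 59768832 * w^3)"
definition theta_gauge2 :: "complex \<Rightarrow> complex" where
  "theta_gauge2 w = (1 + 256 * w) * (1 - 64 * w) * (512 * w * (1 - 512 * w) * (1 - 64 * w)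
     - 512 * w * (1 + 256 * w) * (1 - 64 * w) - 128 * w * (1 + 256 * w) * (1 - 512 * w))"

lemma theta_gauge: "theta_at w gauge0 (theta_gauge0 w)" "theta_at w gauge1 (theta_gauge1 w)" "theta_at w gauge2 (theta_gauge2 w)"
proof -
  have *: "theta_at w f (g w)" if "(f has_field_derivative D) (at w)" "w * D = g w" for f g D
    using that by (auto simp: theta_at_def)
  show "theta_at w gauge0 (theta_gauge0 w)"
    unfolding gauge0_def[abs_def] theta_gauge0_def by (rule *) (rule derivative_eq_intros refl | simp | algebra)+
  show "theta_at w gauge1 (theta_gauge1 w)"
    unfolding gauge1_def[abs_def] theta_gauge1_def by (rule *) (rule derivative_eq_intros refl | simp | algebra)+
  show "theta_at w gauge2 (theta_gauge2 w)"
    unfolding gauge2_def[abs_def] theta_gauge2_def by (rule *) (rule derivative_eq_intros refl | simp | algebra)+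
qed

lemma theta_gauged:
  assumes "theta_at w R (\<sigma> * R w)" "theta_at w N t" "theta_at w D (\<delta> * D w)" "D w \<noteq> 0"
  shows "theta_at w (\<lambda>w. R w * (N w / D w)) (R w * ((\<sigma> * N w + t - N w * \<delta>) / D w))"
proof -
  have "\<sigma> * R w * (N w / D w) + R w * ((t * D w - N w * (\<delta> * D w)) / D w ^ 2)
      = R w * ((\<sigma> * N w + t - N w * \<delta>) / D w)"
    using assms(4) by (simp add: field_simps power2_eq_square)
  then show ?thesis
    using theta_mult[OF assms(1) theta_divide[OF assms(2-4)]] by simp
qed

text \<open>The three coefficients, of \<open>B\<^sub>2\<close>, \<open>B\<^sub>1\<close> and \<open>B\<^sub>0\<close>, of the equation that \<open>\<theta>Z\<^sub>2\<close> has to satisfy. Here \<open>\<sigma>\<close> and \<open>\<delta>\<close>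
  are the logarithmic \<open>\<theta>\<close>-derivatives of \<open>\<rho>\<close> and of the common denominator, while \<open>\<kappa>\<close> and \<open>\<mu>\<close> are the
  factors in the last equations of the systems of \<open>z\<close> and \<open>X\<close>. The numbers \<open>3/2, 23/36, 5/72\<close> and
  \<open>3/2, 11/16, 3/32\<close> are the elementary symmetric functions of the upper parameters
  \<open>1/6, 1/2, 5/6\<close> and \<open>1/4, 1/2, 3/4\<close>. Each identity depends on the choice of \<open>z\<close>, \<open>X\<close> and \<open>\<rho>\<close>.\<close>

lemma gauge_identities:
  fixes w :: complex
  assumes "1 + 256 * w \<noteq> 0" "1 + 64 * w \<noteq> 0" "1 - 512 * w \<noteq> 0" "1 - 64 * w \<noteq> 0"
  defines "p \<equiv> 1 + 256 * w" and "q \<equiv> 1 + 64 * w" and "r \<equiv> 1 - 512 * w" and "s \<equiv> 1 - 64 * w"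
  defines "\<sigma> \<equiv> 96 * w / (p * q)" and "\<delta> \<equiv> 128 * w / q - 1536 * w / r"
    and "\<kappa> \<equiv> 1728 * w / (p * q * r)" and "\<mu> \<equiv> 256 * w / (q * s)"
  shows "\<sigma> * gauge2 w + theta_gauge2 w + gauge1 w * (s / q) + gauge2 w * \<mu> * (3/2) - gauge2 w * \<delta> = \<kappa> * (3/2) * gauge2 w"
    "\<sigma> * gauge1 w + theta_gauge1 w + gauge0 w * (s / q) + gauge2 w * \<mu> * (11/16) - gauge1 w * \<delta>
       = \<kappa> * (3/2 * gauge1 w + 23/36 * (p * q * r^2 * s))"
    "\<sigma> * gauge0 w + theta_gauge0 w + gauge2 w * \<mu> * (3/32) - gauge0 w * \<delta>
       = \<kappa> * (3/2 * gauge0 w + 23/36 * (96 * w * q * r^2) + 5/72 * (q^2 * r^3))"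
proof -
  have nz: "p \<noteq> 0" "q \<noteq> 0" "r \<noteq> 0" "s \<noteq> 0" using assms by auto
  note d = p_def q_def r_def s_def
  show "\<sigma> * gauge2 w + theta_gauge2 w + gauge1 w * (s / q) + gauge2 w * \<mu> * (3/2) - gauge2 w * \<delta> = \<kappa> * (3/2) * gauge2 w"
    unfolding \<sigma>_def \<delta>_def \<kappa>_def \<mu>_def using nz apply (simp add: divide_simps)
    unfolding gauge2_def gauge1_def theta_gauge2_def d by algebra
  show "\<sigma> * gauge1 w + theta_gauge1 w + gauge0 w * (s / q) + gauge2 w * \<mu> * (11/16) - gauge1 w * \<delta>
       = \<kappa> * (3/2 * gauge1 w + 23/36 * (p * q * r^2 * s))"
    unfolding \<sigma>_def \<delta>_def \<kappa>_def \<mu>_def using nz apply (simp add: divide_simps)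
    unfolding gauge2_def gauge1_def gauge0_def theta_gauge1_def d by algebra
  show "\<sigma> * gauge0 w + theta_gauge0 w + gauge2 w * \<mu> * (3/32) - gauge0 w * \<delta>
       = \<kappa> * (3/2 * gauge0 w + 23/36 * (96 * w * q * r^2) + 5/72 * (q^2 * r^3))"
    unfolding \<sigma>_def \<delta>_def \<kappa>_def \<mu>_def using nz apply (simp add: divide_simps)
    unfolding gauge2_def gauge0_def theta_gauge0_def d by algebra
qed

definition gauged1 ::
  "(complex \<Rightarrow> complex) \<Rightarrow> (complex \<Rightarrow> complex) \<Rightarrow> (complex \<Rightarrow> complex) \<Rightarrow> complex \<Rightarrow> complex" where
  "gauged1 R B0 B1 w = R w * ((96 * w * B0 w + (1 + 256 * w) * (1 - 64 * w) * B1 w) / ((1 + 64 * w) * (1 - 512 * w)))"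

definition gauged2 ::
  "(complex \<Rightarrow> complex) \<Rightarrow> (complex \<Rightarrow> complex) \<Rightarrow> (complex \<Rightarrow> complex) \<Rightarrow>
   (complex \<Rightarrow> complex) \<Rightarrow> complex \<Rightarrow> complex" where
  "gauged2 R B0 B1 B2 w =
     R w * ((gauge0 w * B0 w + gauge1 w * B1 w + gauge2 w * B2 w) / ((1 + 64 * w) ^ 2 * (1 - 512 * w) ^ 3))"

lemma gauge_step0:
  assumes nz: "1 + 256 * w \<noteq> 0" "1 + 64 * w \<noteq> 0" "1 - 512 * w \<noteq> 0" "1 - 64 * w \<noteq> 0"
    and R: "theta_at w R (96 * w / ((1 + 256 * w) * (1 + 64 * w)) * R w)"
    and B0: "theta_at w B0 (Xw_dlog w * B1 w)"
  shows "theta_at w (\<lambda>w. R w * B0 w) (zw_dlog w * gauged1 R B0 B1 w)"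
proof -
  define p q r s where d: "p = 1 + 256 * w" "q = 1 + 64 * w" "r = 1 - 512 * w" "s = 1 - 64 * w"
  have "96 * w / (p * q) * R w * B0 w + R w * (s / q * B1 w)
     = r / p * (R w * ((96 * w * B0 w + p * s * B1 w) / (q * r)))"
    using nz[folded d] by (simp add: field_simps)
  then show ?thesis
    using theta_mult[OF R B0] unfolding gauged1_def zw_dlog_def Xw_dlog_def d by simp
qed

lemma gauge_step1:
  assumes nz: "1 + 256 * w \<noteq> 0" "1 + 64 * w \<noteq> 0" "1 - 512 * w \<noteq> 0" "1 - 64 * w \<noteq> 0"
    and R: "theta_at w R (96 * w / ((1 + 256 * w) * (1 + 64 * w)) * R w)"
    and B0: "theta_at w B0 (Xw_dlog w * B1 w)" and B1: "theta_at w B1 (Xw_dlog w * B2 w)"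
  shows "theta_at w (gauged1 R B0 B1) (zw_dlog w * gauged2 R B0 B1 B2 w)"
proof -
  define p q r s where d: "p = 1 + 256 * w" "q = 1 + 64 * w" "r = 1 - 512 * w" "s = 1 - 64 * w"
  note nz' = nz[folded d]
  define \<delta> where "\<delta> = 64 * w / q - 512 * w / r"
  have D: "theta_at w (\<lambda>w. (1 + 64 * w) * (1 - 512 * w)) (\<delta> * ((1 + 64 * w) * (1 - 512 * w)))"
  proof -
    have "\<delta> * (q * r) = 64 * w * r + q * (- 512 * w)"
      using nz' by (simp add: \<delta>_def field_simps)
    then show ?thesis
      unfolding d using theta_mult[OF theta_linear theta_linear_minus] by simp
  qed
  have N: "theta_at w (\<lambda>w. 96 * w * B0 w + (1 + 256 * w) * (1 - 64 * w) * B1 w)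
     ((0 * w + 96 * w) * B0 w + 96 * w * (Xw_dlog w * B1 w)
       + ((256 * w * (1 - 64 * w) + (1 + 256 * w) * (- 64 * w)) * B1 w
            + (1 + 256 * w) * (1 - 64 * w) * (Xw_dlog w * B2 w)))"
    by (intro theta_add theta_mult theta_const theta_id theta_linear theta_linear_minus B0 B1)
  have "theta_at w (gauged1 R B0 B1)
     (R w * ((96 * w / (p * q) * (96 * w * B0 w + p * s * B1 w)
         + ((0 * w + 96 * w) * B0 w + 96 * w * (s / q * B1 w)
              + ((256 * w * s + p * (- 64 * w)) * B1 w + p * s * (s / q * B2 w)))
         - (96 * w * B0 w + p * s * B1 w) * \<delta>) / (q * r)))"
    using theta_gauged[OF R N D] nz unfolding gauged1_def[abs_def] Xw_dlog_def d by simp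
  also have "96 * w / (p * q) * (96 * w * B0 w + p * s * B1 w)
         + ((0 * w + 96 * w) * B0 w + 96 * w * (s / q * B1 w)
              + ((256 * w * s + p * (- 64 * w)) * B1 w + p * s * (s / q * B2 w)))
         - (96 * w * B0 w + p * s * B1 w) * \<delta>
     = (gauge0 w * B0 w + gauge1 w * B1 w + gauge2 w * B2 w) / (p * q * r)"
    using nz' unfolding \<delta>_def apply (simp add: divide_simps)
    unfolding gauge0_def gauge1_def gauge2_def d by algebra
  also have "R w * ((gauge0 w * B0 w + gauge1 w * B1 w + gauge2 w * B2 w) / (p * q * r) / (q * r))
      = r / p * (R w * ((gauge0 w * B0 w + gauge1 w * B1 w + gauge2 w * B2 w) / (q ^ 2 * r ^ 3)))"
    using nz' by (simp add: divide_simps power2_eq_square power3_eq_cube)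
  finally show ?thesis unfolding gauged2_def zw_dlog_def d .
qed

lemma gauge_step2:
  assumes nz: "1 + 256 * w \<noteq> 0" "1 + 64 * w \<noteq> 0" "1 - 512 * w \<noteq> 0" "1 - 64 * w \<noteq> 0"
    and R: "theta_at w R (96 * w / ((1 + 256 * w) * (1 + 64 * w)) * R w)"
    and B0: "theta_at w B0 (Xw_dlog w * B1 w)" and B1: "theta_at w B1 (Xw_dlog w * B2 w)"
    and B2: "theta_at w B2 (Xw_dlog w * (Xw w / (1 - Xw w)) * (3/2 * B2 w + 11/16 * B1 w + 3/32 * B0 w))"
  shows "theta_at w (gauged2 R B0 B1 B2) (zw_dlog w * (zw w / (1 - zw w)) *
     (3/2 * gauged2 R B0 B1 B2 w + 23/36 * gauged1 R B0 B1 w + 5/72 * (R w * B0 w)))"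
proof -
  define p q r s where d: "p = 1 + 256 * w" "q = 1 + 64 * w" "r = 1 - 512 * w" "s = 1 - 64 * w"
  note nz' = nz[folded d]
  define \<sigma> where "\<sigma> = 96 * w / (p * q)"
  define \<delta> where "\<delta> = 128 * w / q - 1536 * w / r"
  define \<kappa> where "\<kappa> = 1728 * w / (p * q * r)"
  define \<mu> where "\<mu> = 256 * w / (q * s)"
  note id = gauge_identities[OF nz, folded d, folded \<sigma>_def \<delta>_def \<kappa>_def \<mu>_def]
  have D: "theta_at w (\<lambda>w. (1 + 64 * w) ^ 2 * (1 - 512 * w) ^ 3) (\<delta> * ((1 + 64 * w) ^ 2 * (1 - 512 * w) ^ 3))"
  proof -
    have "\<delta> * (q ^ 2 * r ^ 3) = of_nat 2 * q ^ (2 - 1) * (64 * w) * r ^ 3 + q ^ 2 * (of_nat 3 * r ^ (3 - 1) * (- 512 * w))"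
      using nz' by (simp add: \<delta>_def field_simps power2_eq_square power3_eq_cube)
    then show ?thesis
      unfolding d using theta_mult[OF theta_power[OF theta_linear] theta_power[OF theta_linear_minus], of w 64 2 512 3] by simp
  qed
  define b where "b = \<mu> * (3/2 * B2 w + 11/16 * B1 w + 3/32 * B0 w)"
  define t where "t = theta_gauge0 w * B0 w + gauge0 w * (Xw_dlog w * B1 w) + (theta_gauge1 w * B1 w + gauge1 w * (Xw_dlog w * B2 w))
     + (theta_gauge2 w * B2 w + gauge2 w * b)"
  have "theta_at w B2 b"
    using B2 unfolding Xw_last_row_factor[OF nz(2,4)] b_def \<mu>_def d .
  then have N: "theta_at w (\<lambda>w. gauge0 w * B0 w + gauge1 w * B1 w + gauge2 w * B2 w) t"
    unfolding t_def by (intro theta_add theta_mult theta_gauge B0 B1)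
  define N where "N = gauge0 w * B0 w + gauge1 w * B1 w + gauge2 w * B2 w"
  have "theta_at w (gauged2 R B0 B1 B2) (R w * ((\<sigma> * N + t - N * \<delta>) / (q ^ 2 * r ^ 3)))"
    using theta_gauged[OF R N D] nz unfolding gauged2_def[abs_def] N_def \<sigma>_def d by simp
  also have "\<sigma> * N + t - N * \<delta> =
      (\<sigma> * gauge2 w + theta_gauge2 w + gauge1 w * (s / q) + gauge2 w * \<mu> * (3/2) - gauge2 w * \<delta>) * B2 w
    + (\<sigma> * gauge1 w + theta_gauge1 w + gauge0 w * (s / q) + gauge2 w * \<mu> * (11/16) - gauge1 w * \<delta>) * B1 w
    + (\<sigma> * gauge0 w + theta_gauge0 w + gauge2 w * \<mu> * (3/32) - gauge0 w * \<delta>) * B0 w"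
    unfolding N_def t_def b_def Xw_dlog_def d(2)[symmetric] d(4)[symmetric] by (simp add: algebra_simps)
  also have "\<dots> = \<kappa> * (3/2 * N + 23/36 * (q * r^2 * (96 * w * B0 w + p * s * B1 w)) + 5/72 * (q^2 * r^3 * B0 w))"
    unfolding id N_def by algebra
  also have "R w * (\<dots> / (q ^ 2 * r ^ 3)) = \<kappa> * (3/2 * (R w * (N / (q ^ 2 * r ^ 3)))
      + 23/36 * (R w * ((96 * w * B0 w + p * s * B1 w) / (q * r))) + 5/72 * (R w * B0 w))"
    using nz' by (simp add: field_simps power2_eq_square power3_eq_cube)
  finally show ?thesis
    unfolding zw_last_row_factor[OF nz(1-3)] gauged1_def gauged2_def N_def \<kappa>_def d .
qed

lemma eventually_linear_nonzero: "\<forall>\<^sub>F w in nhds 0. 1 + c * w \<noteq> (0::complex)"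
proof -
  have "((\<lambda>w. 1 + c * w) \<longlongrightarrow> 1 + c * 0) (nhds 0)"
    by (intro tendsto_intros filterlim_ident)
  from tendsto_imp_eventually_ne[OF this, of 0] show ?thesis by simp
qed

text \<open>Multiplication by \<open>\<rho>\<close> carries the companion system of \<open>X\<close> into that of \<open>z\<close>.\<close>

theorem gauge_companion_germ:
  assumes R: "R analytic_on {0}" and R2: "\<forall>\<^sub>F w in nhds 0. R w ^ 2 = (1 + 256 * w) / (1 + 64 * w)"
    and B: "companion_germ Xw_dlog (\<lambda>w. Xw_dlog w * (Xw w / (1 - Xw w))) (3/2) (11/16) (3/32) B0 B1 B2"
  shows "companion_germ zw_dlog (\<lambda>w. zw_dlog w * (zw w / (1 - zw w))) (3/2) (23/36) (5/72)
     (\<lambda>w. R w * B0 w) (gauged1 R B0 B1) (gauged2 R B0 B1 B2)"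
  unfolding companion_germ_def
proof (intro conjI)
  have an: "B0 analytic_on {0}" "B1 analytic_on {0}" "B2 analytic_on {0}"
    using B by (auto simp: companion_germ_def)
  show "(\<lambda>w. R w * B0 w) analytic_on {0}" "gauged1 R B0 B1 analytic_on {0}" "gauged2 R B0 B1 B2 analytic_on {0}"
    unfolding gauged1_def[abs_def] gauged2_def[abs_def] gauge0_def gauge1_def gauge2_def
    by (intro analytic_intros R an; simp)+
  have "\<forall>\<^sub>F w in nhds 0. R analytic_on {w}"
    using R unfolding analytic_at eventually_nhds by blast
  moreover have "\<forall>\<^sub>F w in nhds 0. \<forall>\<^sub>F w in nhds w. R w ^ 2 = (1 + 256 * w) / (1 + 64 * w)"
    using R2 by (simp add: eventually_eventually)
  moreover note eventually_linear_nonzero[of 256] eventually_linear_nonzero[of 64]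
    eventually_linear_nonzero[of "-512"] eventually_linear_nonzero[of "-64"]
  moreover have "\<forall>\<^sub>F w in nhds 0. theta_at w B0 (Xw_dlog w * B1 w) \<and> theta_at w B1 (Xw_dlog w * B2 w) \<and>
        theta_at w B2 (Xw_dlog w * (Xw w / (1 - Xw w)) * (3/2 * B2 w + 11/16 * B1 w + 3/32 * B0 w))"
    using B by (auto simp: companion_germ_def)
  ultimately show "\<forall>\<^sub>F w in nhds 0. theta_at w (\<lambda>w. R w * B0 w) (zw_dlog w * gauged1 R B0 B1 w) \<and>
     theta_at w (gauged1 R B0 B1) (zw_dlog w * gauged2 R B0 B1 B2 w) \<and>
     theta_at w (gauged2 R B0 B1 B2) (zw_dlog w * (zw w / (1 - zw w)) *
       (3/2 * gauged2 R B0 B1 B2 w + 23/36 * gauged1 R B0 B1 w + 5/72 * (R w * B0 w)))"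
  proof eventually_elim
    case (elim w)
    then have nz: "1 + 256 * w \<noteq> 0" "1 + 64 * w \<noteq> 0" "1 - 512 * w \<noteq> 0" "1 - 64 * w \<noteq> 0"
      by auto
    note rho = theta_rho[OF elim(1,2) nz(1,2)]
    show ?case
      using gauge_step0[OF nz rho] gauge_step1[OF nz rho] gauge_step2[OF nz rho] elim(7) by blast
  qed
qed

text \<open>Both sides solve the companion system of \<open>z\<close> and have the value \<open>1\<close> at the cusp, so their difference is
  the zero solution.\<close>

theorem hypergeometric_germ_identity:
  assumes R: "R analytic_on {0}" and R2: "\<forall>\<^sub>F w in nhds 0. R w ^ 2 = (1 + 256 * w) / (1 + 64 * w)"
    and R0: "R 0 = 1"
  shows "\<forall>\<^sub>F w in nhds 0. F1 (zw w) = R w * F2 (Xw w)"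
proof -
  have an: "zw analytic_on {0}" "Xw analytic_on {0}" "zw_dlog analytic_on {0}" "Xw_dlog analytic_on {0}"
    unfolding zw_def[abs_def] Xw_def[abs_def] zw_dlog_def[abs_def] Xw_dlog_def[abs_def]
    by (intro analytic_intros; simp)+
  have at0: "zw 0 = 0" "Xw 0 = 0" "zw_dlog 0 = 1" by (simp_all add: zw_def Xw_def zw_dlog_def)
  have "\<forall>\<^sub>F w in nhds 0. theta_at w zw (zw_dlog w * zw w)"
    using eventually_linear_nonzero[of 256] by eventually_elim (rule theta_zw)
  from hyp_pullback_companion_germ[OF an(1) at0(1) this, of "1/6" "1/2" "5/6"]
  obtain Y1 Y2 where Y: "companion_germ zw_dlog (\<lambda>w. zw_dlog w * (zw w / (1 - zw w))) (3/2) (23/36) (5/72)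
      (\<lambda>w. F1 (zw w)) Y1 Y2"
    unfolding F_hyp by auto
  have "\<forall>\<^sub>F w in nhds 0. theta_at w Xw (Xw_dlog w * Xw w)"
    using eventually_linear_nonzero[of 64] by eventually_elim (rule theta_Xw)
  from hyp_pullback_companion_germ[OF an(2) at0(2) this, of "1/4" "1/2" "3/4"]
  obtain B1 B2 where B: "companion_germ Xw_dlog (\<lambda>w. Xw_dlog w * (Xw w / (1 - Xw w))) (3/2) (11/16) (3/32)
      (\<lambda>w. F2 (Xw w)) B1 B2"
    unfolding F_hyp by auto
  have "\<forall>\<^sub>F w in nhds 0. F1 (zw w) - R w * F2 (Xw w) = 0"
  proof (rule companion_germ_unique[OF companion_germ_diff[OF Y gauge_companion_germ[OF R R2 B]]])
    show "(\<lambda>w. zw_dlog w * (zw w / (1 - zw w))) analytic_on {0}"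
      by (intro analytic_intros an) (simp add: at0)
    show "F1 (zw 0) - R 0 * F2 (Xw 0) = 0"
      by (simp add: at0 R0 F1_def F2_def eval_fps_at_0)
  qed (simp_all add: an at0)
  then show ?thesis by simp
qed

section \<open>The chart at infinity and admissible regions\<close>

definition chart_inverse :: "complex option \<Rightarrow> complex" where
  "chart_inverse p = (case p of None \<Rightarrow> 0 | Some t \<Rightarrow> inverse t)"

lemma chart_inverse_simps [simp]:
  "chart_inverse None = 0" "chart_inverse (Some t) = inverse t"
  by (simp_all add: chart_inverse_def)

lemma chart_inverse_chart [simp]: "chart_inverse (chart_infinity w) = w"
  by (simp add: chart_infinity_def)

lemma inj_chart: "inj chart_infinity"
  by (rule inj_on_inverseI[where g = chart_inverse]) simp

lemma chart_chart_inverse: "p \<noteq> Some 0 \<Longrightarrow> chart_infinity (chart_inverse p) = p"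
  by (cases p) (auto simp: chart_infinity_def)

lemma open_inverse_vimage:
  fixes W :: "complex set"
  assumes "open W"
  shows "open {w. w \<noteq> 0 \<and> inverse w \<in> W}"
proof -
  have "open (inverse -` W \<inter> - {0::complex})"
    by (rule continuous_on_open_vimage[THEN iffD1, rule_format]) (auto intro!: continuous_intros assms)
  also have "inverse -` W \<inter> - {0} = {w. w \<noteq> 0 \<and> inverse w \<in> W}" by auto
  finally show ?thesis .
qed

text \<open>Neighbourhoods of \<^term>\<open>None\<close> are complements of compact sets. Continuity at \<open>w = 0\<close> means that \<open>1 / w\<close>
  leaves every compact set.\<close>

lemma continuous_map_chart: "continuous_map euclidean sphere_top chart_infinity"
  unfolding continuous_map_def
proof (intro conjI allI impI)
  fix U assume "openin sphere_top U"
  then consider W where "open W" "U = Some ` W"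
    | C where "compact C" "U = insert None (Some ` (UNIV - C))"
    by (auto simp: sphere_top_def openin_Alexandroff_compactification)
  then have "open {w. chart_infinity w \<in> U}"
  proof cases
    case 1
    then have "{w. chart_infinity w \<in> U} = {w. w \<noteq> 0 \<and> inverse w \<in> W}"
      by (auto simp: chart_infinity_def)
    then show ?thesis using open_inverse_vimage[OF 1(1)] by simp
  next
    case 2
    obtain B where B: "B > 0" "\<And>x. x \<in> C \<Longrightarrow> norm x \<le> B"
      using compact_imp_bounded[OF 2(1)] by (auto simp: bounded_pos)
    have ball: "inverse w \<notin> C" if "w \<in> ball 0 (inverse B)" "w \<noteq> 0" for w
    proof
      assume "inverse w \<in> C"
      then have "inverse (norm w) \<le> B" using B(2) by (metis norm_inverse)
      with that B(1) show False by (simp add: field_simps)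
    qed
    then have "{w. chart_infinity w \<in> U} = {w. w \<noteq> 0 \<and> inverse w \<in> - C} \<union> ball 0 (inverse B)"
      using 2(2) B(1) by (auto simp: chart_infinity_def)
    then show ?thesis
      using open_inverse_vimage[OF open_Compl[OF compact_imp_closed[OF 2(1)]]] by (simp add: open_Un)
  qed
  then show "openin euclidean {x \<in> topspace euclidean. chart_infinity x \<in> U}" by simp
qed (auto simp: sphere_top_def chart_infinity_def)

lemma open_map_chart: "open_map euclidean sphere_top chart_infinity"
  unfolding open_map_def
proof (intro allI impI)
  fix W :: "complex set" assume "openin euclidean W"
  then have W: "open W" by simp
  note iW = open_inverse_vimage[OF W]
  have im: "chart_infinity ` W =
     (if 0 \<in> W then insert None else id) (Some ` {t. t \<noteq> 0 \<and> inverse t \<in> W})"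
    by (force simp: chart_infinity_def image_iff)
  show "openin sphere_top (chart_infinity ` W)"
  proof (cases "0 \<in> W")
    case False
    then show ?thesis using iW im by (simp add: sphere_top_def)
  next
    case True
    define C where "C = - {t. t \<noteq> 0 \<and> inverse t \<in> W}"
    obtain e where e: "e > 0" "ball 0 e \<subseteq> W" using W True openE by blast
    have "norm t \<le> inverse e" if "t \<in> C" for t
    proof (rule ccontr)
      assume "\<not> norm t \<le> inverse e"
      then have t: "inverse e < norm t" "0 < inverse e" using e(1) by auto
      then have "t \<noteq> 0" by auto
      moreover have "norm (inverse t) < e"
        using less_imp_inverse_less[OF t] by (simp add: norm_inverse)
      ultimately have "t \<noteq> 0" "norm (inverse t) < e" by auto
      then show False using that e(2) by (auto simp: C_def)
    qed
    then have "compact C"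
      using iW by (auto simp: compact_eq_bounded_closed C_def closed_def bounded_iff)
    moreover have "chart_infinity ` W = insert None (Some ` (UNIV - C))"
      using True im by (simp add: C_def Compl_eq_Diff_UNIV[symmetric])
    ultimately show ?thesis
      unfolding sphere_top_def openin_Alexandroff_compactification
      by (intro disjI2 exI[of _ C]) (simp add: compact_imp_closed)
  qed
qed

lemma homeomorphic_map_chart:
  "homeomorphic_map (top_of_set V) (subtopology sphere_top (chart_infinity ` V)) chart_infinity"
proof -
  have "embedding_map euclidean sphere_top chart_infinity"
    by (rule injective_open_imp_embedding_map[OF continuous_map_chart open_map_chart]) (use inj_chart in simp)
  then have "homeomorphic_map euclidean (subtopology sphere_top (range chart_infinity)) chart_infinity"
    by (simp add: embedding_map_def)
  then have "homeomorphic_map (top_of_set V)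
      (subtopology (subtopology sphere_top (range chart_infinity)) (chart_infinity ` V)) chart_infinity"
    by (rule homeomorphic_map_subtopologies) (auto simp: sphere_top_def, metis not_None_eq rangeI)
  then show ?thesis
    by (simp add: subtopology_subtopology Int_absorb1 image_mono)
qed

lemma simply_connected_space_homeomorphic_maps:
  assumes "homeomorphic_maps X Y f g" "simply_connected_space X"
  shows "simply_connected_space Y"
  unfolding simply_connected_space_def
proof (intro allI impI, elim conjE)
  fix p q :: "real \<Rightarrow> 'b"
  assume pq: "pathin Y p" "p 1 = p 0" "pathin Y q" "q 1 = q 0"
  have f: "continuous_map X Y f" and g: "continuous_map Y X g" and fg: "\<And>y. y \<in> topspace Y \<Longrightarrow> f (g y) = y"
    using assms(1) by (auto simp: homeomorphic_maps_def)
  have "homotopic_with (\<lambda>r. r 1 = r 0) (top_of_set {0..1}) X (g \<circ> p) (g \<circ> q)"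
    using assms(2) pq pathin_compose[OF _ g] unfolding simply_connected_space_def by simp
  then have "homotopic_with (\<lambda>r. r 1 = r 0) (top_of_set {0..1}) Y (f \<circ> (g \<circ> p)) (f \<circ> (g \<circ> q))"
    by (rule homotopic_with_compose_continuous_map_left[OF _ f]) simp
  then show "homotopic_with (\<lambda>r. r 1 = r 0) (top_of_set {0..1}) Y p q"
  proof (rule homotopic_with_eq)
    fix x :: real assume "x \<in> topspace (top_of_set {0..1})"
    then have "p x \<in> topspace Y" "q x \<in> topspace Y"
      using pq by (auto simp: pathin_def continuous_map_def)
    then show "p x = (f \<circ> (g \<circ> p)) x" "q x = (f \<circ> (g \<circ> q)) x" by (simp_all add: fg)
  qed simp
qed

lemma simply_connected_space_top_of_set:
  "simply_connected_space (top_of_set V) \<longleftrightarrow> simply_connected V"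
proof -
  have "pathin (top_of_set V) p \<longleftrightarrow> path p \<and> path_image p \<subseteq> V" for p :: "real \<Rightarrow> 'a"
    by (auto simp: pathin_def path_def path_image_def image_subset_iff)
  then show ?thesis
    unfolding simply_connected_space_def simply_connected_def homotopic_loops_def
      pathfinish_def pathstart_def
    by auto
qed

lemma simply_connected_space_chart_image:
  "simply_connected_space (subtopology sphere_top (chart_infinity ` V)) \<longleftrightarrow> simply_connected V"
proof -
  obtain g where g: "homeomorphic_maps (top_of_set V) (subtopology sphere_top (chart_infinity ` V)) chart_infinity g"
    using homeomorphic_map_chart homeomorphic_map_maps by blast
  then show ?thesis
    using simply_connected_space_homeomorphic_maps[OF g] simply_connected_space_homeomorphic_maps[OF g[THEN homeomorphic_maps_sym[THEN iffD1]]]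
    unfolding simply_connected_space_top_of_set by blast
qed

text \<open>The nonzero singular values in the coordinate \<open>w\<close>; the singular value \<open>t = 0\<close> lies outside the chart.\<close>

definition singular_points :: "complex set" where
  "singular_points = {1/64, -1/64, -1/256, 1/512}"

lemma chart_singular: "chart_infinity w \<in> Some ` singular_values \<longleftrightarrow> w \<in> singular_points"
proof -
  have *: "inverse w = c \<longleftrightarrow> w = inverse c" for c :: complex
    by (metis inverse_inverse_eq)
  show ?thesis
    by (auto simp: chart_infinity_def singular_values_def singular_points_def *)
qed

lemma admissible_region_chart_image:
  assumes "open V" "simply_connected V" "0 \<in> V" "V \<inter> singular_points = {}"
  shows "admissible_region (chart_infinity ` V)"
  unfolding admissible_region_def
proof (intro conjI)
  show "openin sphere_top (chart_infinity ` V)"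
    using open_map_chart assms(1) by (simp add: open_map_def)
  show "connectedin sphere_top (chart_infinity ` V)"
    by (rule connectedin_continuous_map_image[OF continuous_map_chart])
       (use simply_connected_imp_connected[OF assms(2)] in simp)
  show "simply_connected_space (subtopology sphere_top (chart_infinity ` V))"
    using assms(2) by (simp add: simply_connected_space_chart_image)
  show "None \<in> chart_infinity ` V"
    using assms(3) by (auto simp: chart_infinity_def intro: image_eqI[of _ _ 0])
  show "chart_infinity ` V \<inter> Some ` singular_values = {}"
    using assms(4) chart_singular by blast
qed

text \<open>An admissible region omits \<^term>\<open>Some 0\<close>, the only point of the sphere outside the range of the chart.\<close>

lemma admissible_regionE:
  assumes "admissible_region U"
  obtains V where "U = chart_infinity ` V" "open V" "simply_connected V" "0 \<in> V" "V \<inter> singular_points = {}"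
proof
  let ?V = "chart_infinity -` U"
  have "Some 0 \<notin> U" using assms by (auto simp: admissible_region_def singular_values_def)
  then show U: "U = chart_infinity ` ?V"
    by (metis chart_chart_inverse image_vimage_eq inf.absorb1 rangeI subsetI)
  show "open ?V"
    using continuous_map_chart assms by (simp add: admissible_region_def continuous_map_def vimage_def)
  show "simply_connected ?V"
    using assms U simply_connected_space_chart_image[of ?V] by (simp add: admissible_region_def)
  show "0 \<in> ?V" using assms by (simp add: admissible_region_def chart_infinity_def)
  show "?V \<inter> singular_points = {}"
    using assms chart_singular by (auto simp: admissible_region_def)
qed

lemma eventually_at_infinity_inverse:
  "(\<forall>\<^sub>F t in at_infinity. P t) \<longleftrightarrow> (\<forall>\<^sub>F w in at (0::complex). P (inverse w))"
  by (subst at_to_infinity) (simp add: eventually_filtermap)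

text \<open>The chart covers the region, and the finite part of the condition follows from it since \<open>t \<mapsto> 1 / t\<close> is
  holomorphic away from \<open>0\<close>.\<close>

lemma continues_germ_chart_image:
  assumes "open V" "0 \<in> V"
  shows "continues_germ_at_infinity G (chart_infinity ` V) f \<longleftrightarrow>
    (\<lambda>w. G (chart_infinity w)) holomorphic_on V \<and>
    (\<forall>\<^sub>F w in at 0. G (chart_infinity w) = f (inverse w))"
proof -
  have "(\<forall>\<^sub>F w in at 0. G (Some (inverse w)) = f (inverse w)) \<longleftrightarrow>
    (\<forall>\<^sub>F w in at 0. G (chart_infinity w) = f (inverse w))"
    by (rule eventually_cong[OF eventually_neq_at_within[of 0]]) (simp add: chart_infinity_def)
  moreover have "(\<lambda>t. G (Some t)) holomorphic_on Some -` chart_infinity ` V"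
    if hol: "(\<lambda>w. G (chart_infinity w)) holomorphic_on V"
  proof -
    have S: "t \<noteq> 0 \<and> inverse t \<in> V" if "t \<in> Some -` chart_infinity ` V" for t
      using that by (auto simp: chart_infinity_def split: if_splits)
    have "(\<lambda>t. G (chart_infinity (inverse t))) holomorphic_on Some -` chart_infinity ` V"
      using holomorphic_on_compose_gen[OF _ hol, of inverse "Some -` chart_infinity ` V"] S
      by (force simp: o_def intro!: holomorphic_intros)
    then show ?thesis
    proof (rule holomorphic_transform)
      fix t assume "t \<in> Some -` chart_infinity ` V"
      then have "t \<noteq> 0" using S by blast
      then show "G (chart_infinity (inverse t)) = G (Some t)" by (simp add: chart_infinity_def)
    qed
  qed
  ultimately show ?thesis
    unfolding continues_germ_at_infinity_def sphere_holomorphic_on_def eventually_at_infinity_inverse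
    by (auto simp: inj_vimage_image_eq[OF inj_chart])
qed

text \<open>The identity theorem on the component of \<open>S \<inter> T\<close> that contains \<open>C\<close>. It serves both for uniqueness on a
  whole domain, with \<open>C = S = T\<close>, and for comparison along a segment, where \<open>S \<inter> T\<close> may be disconnected.\<close>

lemma holomorphic_agree_on_connected:
  assumes f: "f holomorphic_on S" "open S" and g: "g holomorphic_on T" "open T"
    and C: "connected C" "C \<subseteq> S \<inter> T" "0 \<in> C"
    and ev: "\<forall>\<^sub>F w in at 0. f w = g w" and w: "w \<in> C"
  shows "f w = g w"
proof -
  define K where "K = connected_component_set (S \<inter> T) 0"
  have K: "open K" "connected K" "K \<subseteq> S" "K \<subseteq> T"
    using f(2) g(2) connected_component_subset[of "S \<inter> T" 0]
    by (auto simp: K_def intro!: open_connected_component open_Int)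
  have CK: "C \<subseteq> K" unfolding K_def using C by (intro connected_component_maximal)
  have "(\<lambda>w. f w - g w) holomorphic_on K"
    using f g K by (intro holomorphic_intros) (auto intro: holomorphic_on_subset)
  then have "f w - g w = 0"
  proof (rule analytic_continuation[of _ K "{w \<in> K. f w = g w}" 0])
    have "\<forall>\<^sub>F w in at 0. w \<in> K"
      using K(1) C(3) CK by (intro eventually_at_in_open') auto
    with ev have "\<forall>\<^sub>F w in at 0. w \<in> {w \<in> K. f w = g w}"
      by eventually_elim simp
    then show "0 islimpt {w \<in> K. f w = g w}"
      unfolding islimpt_conv_frequently_at by (rule eventually_frequently[rotated]) simp
  qed (use K CK C w in auto)
  then show ?thesis by simp
qed

text \<open>Equal squares leave only the choice \<open>f x = - g x\<close>, which is impossible where \<open>f x + g x\<close> is near \<open>2\<close>.\<close>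

lemma eq_of_square_eq_near_one:
  fixes f g :: "'a \<Rightarrow> complex"
  assumes "(f \<longlongrightarrow> 1) F" "(g \<longlongrightarrow> 1) F" "\<forall>\<^sub>F x in F. f x ^ 2 = g x ^ 2"
  shows "\<forall>\<^sub>F x in F. f x = g x"
proof -
  have "((\<lambda>x. f x + g x) \<longlongrightarrow> 1 + 1) F" by (intro tendsto_intros assms)
  then have "\<forall>\<^sub>F x in F. f x + g x \<noteq> 0" by (rule tendsto_imp_eventually_ne) simp
  with assms(3) show ?thesis
    by eventually_elim (auto simp: power2_eq_iff)
qed

section \<open>Continuation to admissible regions and the cusp branch\<close>

lemma zt_inverse: "zt (inverse w) = zw w" if "w \<noteq> 0"
proof -
  have "inverse w + 256 = (1 + 256 * w) / w" using that by (simp add: field_simps)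
  then show ?thesis
    using that by (simp add: zt_def zw_def power_divide field_simps power2_eq_square power3_eq_cube)
qed

lemma Xt_inverse: "Xt (inverse w) = Xw w" if "w \<noteq> 0"
proof -
  have "inverse w + 64 = (1 + 64 * w) / w" using that by (simp add: field_simps)
  then show ?thesis
    using that by (simp add: Xt_def Xw_def power_divide field_simps power2_eq_square)
qed

lemma rho_square_inverse: "(inverse w + 256) / (inverse w + 64) = (1 + 256 * w) / (1 + 64 * w)"
  if "w \<noteq> 0" for w :: "'a :: field_char_0"
proof -
  have "inverse w + 256 = (1 + 256 * w) / w" "inverse w + 64 = (1 + 64 * w) / w"
    using that by (simp_all add: field_simps)
  then show ?thesis using that by simp
qed

lemma hyp_holomorphic: "eval_fps (hyp a b c) holomorphic_on ball 0 1"
  by (intro holomorphic_intros)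
     (auto simp: in_eball_iff one_ereal_def intro!: less_le_trans[OF _ hyp_conv_radius])

lemma closed_real_ray: "closed (complex_of_real ` {1..})"
  by (intro closed_injective_linear_image)
     (auto simp: inj_on_def bounded_linear.linear bounded_linear_of_real)

text \<open>The slit plane is star-shaped about \<open>0\<close>, so \<open>hyp_pullback_continues\<close> applies to the identity map.
  It yields agreement near \<open>0\<close> only; the identity theorem extends this to the unit disc.\<close>

lemma principal_branch_hyp: "\<exists>\<Phi>. principal_branch (eval_fps (hyp a b c)) \<Phi>"
proof -
  let ?S = "- (complex_of_real ` {1..})"
  have op: "open ?S" using closed_real_ray by auto
  have star: "starlike ?S"
    unfolding starlike_def
  proof (intro bexI[of _ 0] ballI subsetI)
    fix x y :: complex assume x: "x \<in> ?S" and y: "y \<in> closed_segment 0 x"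
    then obtain u where u: "0 \<le> u" "u \<le> 1" "y = of_real u * x"
      by (auto simp: closed_segment_def scaleR_conv_of_real)
    show "y \<in> ?S"
    proof (rule ComplI, elim imageE)
      fix s assume s: "y = of_real s" "s \<in> {1..}"
      with u have "u \<noteq> 0" by auto
      with s u have "x = of_real (s / u)" by (simp add: field_simps)
      moreover have "s / u \<in> {1..}" using s u \<open>u \<noteq> 0\<close> by (simp add: field_simps)
      ultimately have "x \<in> complex_of_real ` {1..}" by (rule image_eqI)
      with x show False by blast
    qed
  qed auto
  have "\<exists>H. H holomorphic_on ?S \<and> (\<forall>\<^sub>F w in nhds 0. H w = eval_fps (hyp a b c) w)"
  proof (rule hyp_pullback_continues[where g = "\<lambda>_. 1"])
    show "simply_connected ?S" using star by (rule starlike_imp_simply_connected)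
    have "1 \<in> complex_of_real ` {1..}" by (rule image_eqI[of _ _ 1]) auto
    then show "?S \<noteq> UNIV" "\<And>w. w \<in> ?S \<Longrightarrow> w \<noteq> 1" by auto
    show "theta_at w (\<lambda>a. a) (1 * w)" for w using theta_id by simp
  qed (use op in \<open>auto intro!: holomorphic_intros\<close>)
  then obtain H where H: "H holomorphic_on ?S" "\<forall>\<^sub>F w in nhds 0. H w = eval_fps (hyp a b c) w"
    by blast
  have "H w = eval_fps (hyp a b c) w" if w: "w \<in> ball 0 1" for w
  proof (rule holomorphic_agree_on_connected[OF H(1) op hyp_holomorphic _ _ _ _ _ w])
    show "\<forall>\<^sub>F w in at 0. H w = eval_fps (hyp a b c) w"
      using H(2) by (simp add: eventually_nhds_conv_at)
    show "ball 0 1 \<subseteq> ?S \<inter> ball 0 1" by auto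
  qed (auto simp: connected_ball)
  with H(1) show ?thesis by (auto simp: principal_branch_def)
qed

lemma one_plus_mult_eq_0_iff:
  fixes c w :: "'a :: field"
  assumes "c \<noteq> 0"
  shows "1 + c * w = 0 \<longleftrightarrow> w = - 1 / c"
proof
  assume "1 + c * w = 0"
  then have "c * w = - 1" by (simp add: add_eq_0_iff)
  with assms show "w = - 1 / c" by (metis nonzero_mult_div_cancel_left)
qed (use assms in simp)

lemma nonsingular:
  assumes "V \<inter> singular_points = {}" "w \<in> V"
  shows "1 + 256 * w \<noteq> 0" "1 + 64 * w \<noteq> 0" "1 - 512 * w \<noteq> 0" "1 - 64 * w \<noteq> 0"
proof -
  have "w \<notin> singular_points" using assms by blast
  then have s: "w \<noteq> -1/256" "w \<noteq> -1/64" "w \<noteq> 1/512" "w \<noteq> 1/64"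
    unfolding singular_points_def by blast+
  show "1 + 256 * w \<noteq> 0" "1 + 64 * w \<noteq> 0" "1 - 512 * w \<noteq> 0" "1 - 64 * w \<noteq> 0"
    using s one_plus_mult_eq_0_iff[of 256 w] one_plus_mult_eq_0_iff[of 64 w]
      one_plus_mult_eq_0_iff[of "-512" w] one_plus_mult_eq_0_iff[of "-64" w] by simp_all
qed

lemma exists_rho_branch:
  assumes V: "open V" "simply_connected V" "0 \<in> V" "V \<inter> singular_points = {}"
  shows "\<exists>R. R holomorphic_on V \<and> R 0 = 1 \<and> (\<forall>w\<in>V. R w ^ 2 = (1 + 256 * w) / (1 + 64 * w))"
proof -
  note ns = nonsingular[OF V(4)]
  have "(\<lambda>w. (1 + 256 * w) / (1 + 64 * w)) holomorphic_on V"
    using ns by (intro holomorphic_intros) auto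
  moreover have "\<forall>w\<in>V. (1 + 256 * w) / (1 + 64 * w) \<noteq> 0" using ns by auto
  ultimately obtain g where g: "g holomorphic_on V" "\<forall>w\<in>V. (1 + 256 * w) / (1 + 64 * w) = g w ^ 2"
    using V(2) unfolding simply_connected_eq_holomorphic_sqrt[OF V(1)] by blast
  have "g 0 ^ 2 = 1" using g(2) V(3) by fastforce
  then have "g 0 = 1 \<or> g 0 = -1" by (simp add: power2_eq_1_iff)
  then show ?thesis
  proof
    assume "g 0 = 1" then show ?thesis using g by auto
  next
    assume "g 0 = -1"
    then show ?thesis using g by (intro exI[of _ "\<lambda>w. - g w"]) (auto intro!: holomorphic_intros)
  qed
qed

lemma chart_domain_ne_UNIV: "V \<inter> singular_points = {} \<Longrightarrow> V \<noteq> UNIV"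
  by (auto simp: singular_points_def)

lemma pullbacks_continue:
  assumes V: "open V" "simply_connected V" "0 \<in> V" "V \<inter> singular_points = {}"
  shows "\<exists>A. A holomorphic_on V \<and> (\<forall>\<^sub>F w in nhds 0. A w = F1 (zw w))"
    "\<exists>B. B holomorphic_on V \<and> (\<forall>\<^sub>F w in nhds 0. B w = F2 (Xw w))"
proof -
  note ns = nonsingular[OF V(4)]
  note VU = chart_domain_ne_UNIV[OF V(4)]
  have hol: "zw holomorphic_on V" "Xw holomorphic_on V" "zw_dlog holomorphic_on V" "Xw_dlog holomorphic_on V"
    unfolding zw_def[abs_def] Xw_def[abs_def] zw_dlog_def[abs_def] Xw_dlog_def[abs_def]
    using ns by (intro holomorphic_intros; simp)+
  have ne: "zw w \<noteq> 1" "Xw w \<noteq> 1" if "w \<in> V" for w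
    using one_minus_zw[OF ns(1)[OF that]] one_minus_Xw[OF ns(2)[OF that]] ns[OF that] by auto
  show "\<exists>A. A holomorphic_on V \<and> (\<forall>\<^sub>F w in nhds 0. A w = F1 (zw w))"
    unfolding F_hyp
    by (rule hyp_pullback_continues[OF V(1,2) VU V(3) hol(1) _ ne(1) hol(3) theta_zw])
       (use ns in \<open>auto simp: zw_def\<close>)
  show "\<exists>B. B holomorphic_on V \<and> (\<forall>\<^sub>F w in nhds 0. B w = F2 (Xw w))"
    unfolding F_hyp
    by (rule hyp_pullback_continues[OF V(1,2) VU V(3) hol(2) _ ne(2) hol(4) theta_Xw])
       (use ns in \<open>auto simp: Xw_def\<close>)
qed

lemma continuation_from_chart:
  assumes V: "open V" "0 \<in> V" and H: "H holomorphic_on V" "\<forall>\<^sub>F w in at 0. H w = f (inverse w)"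
  shows "\<exists>G. continues_germ_at_infinity G (chart_infinity ` V) f"
proof (rule exI)
  show "continues_germ_at_infinity (\<lambda>p. H (chart_inverse p)) (chart_infinity ` V) f"
    unfolding continues_germ_chart_image[OF V] chart_inverse_chart using H by blast
qed

lemma agree_on_cusp:
  assumes V: "open V" and seg: "complex_of_real ` {-1/512<..0} \<subseteq> V" and a: "a holomorphic_on V"
    and T: "open T" "\<Phi> holomorphic_on T"
    and ev: "\<forall>\<^sub>F w in at 0. a w = \<Phi> w"
    and segT: "\<And>x. -1/512 < x \<Longrightarrow> x \<le> 0 \<Longrightarrow> complex_of_real x \<in> T"
    and x: "-1/512 < x" "x \<le> 0"
  shows "a (complex_of_real x) = \<Phi> (complex_of_real x)"
proof (rule holomorphic_agree_on_connected[OF a V T(2,1) _ _ _ ev])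
  show "connected (complex_of_real ` {-1/512<..0})"
    by (intro connected_continuous_image continuous_intros) auto
  show "complex_of_real ` {-1/512<..0} \<subseteq> V \<inter> T" using seg segT by auto
  show "0 \<in> complex_of_real ` {-1/512<..0}" by (rule image_eqI[of _ _ 0]) auto
qed (use x in auto)

text \<open>On the segment the pullback \<open>h\<close> takes real values below \<open>1\<close>, so \<open>\<Phi> \<circ> h\<close> is holomorphic in an open set
  containing the segment and starts with the same germ as \<open>a\<close>.\<close>

lemma principal_branch_pullback:
  assumes \<Phi>: "principal_branch F \<Phi>" and h: "h holomorphic_on S" "open S" "0 \<in> S" "h 0 = 0"
    and on_segment: "\<And>x. -1/512 < x \<Longrightarrow> x \<le> 0 \<Longrightarrow> complex_of_real x \<in> S \<and> (\<exists>y<1. h (complex_of_real x) = complex_of_real y)"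
    and V: "open V" "complex_of_real ` {-1/512<..0} \<subseteq> V" "a holomorphic_on V"
    and ev: "\<forall>\<^sub>F w in at 0. a w = F (h w)" and x: "-1/512 < x" "x \<le> 0"
  shows "a (complex_of_real x) = \<Phi> (h (complex_of_real x))"
proof -
  let ?T = "S \<inter> h -` (- (complex_of_real ` {1..}))"
  have cont: "continuous_on S h" using h(1) by (rule holomorphic_on_imp_continuous_on)
  have T: "open ?T" by (rule continuous_open_preimage[OF cont h(2)]) (use closed_real_ray in auto)
  have \<Phi>': "\<Phi> holomorphic_on (- (complex_of_real ` {1..}))" "\<And>z. z \<in> ball 0 1 \<Longrightarrow> \<Phi> z = F z"
    using \<Phi> by (auto simp: principal_branch_def)
  have hol: "(\<lambda>w. \<Phi> (h w)) holomorphic_on ?T"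
    using holomorphic_on_compose_gen[OF holomorphic_on_subset[OF h(1), of ?T] \<Phi>'(1)]
    by (auto simp: o_def image_subset_iff)
  have "isCont h 0" using cont h(2,3) by (simp add: continuous_on_eq_continuous_at)
  then have "\<forall>\<^sub>F w in at 0. h w \<in> ball 0 1"
    using h(4) by (intro topological_tendstoD) (auto simp: isCont_def)
  with ev have "\<forall>\<^sub>F w in at 0. a w = \<Phi> (h w)"
    by eventually_elim (use \<Phi>'(2) in auto)
  then show ?thesis
  proof (rule agree_on_cusp[OF V(1,2,3) T hol _ _ x])
    fix x :: real assume "-1/512 < x" "x \<le> 0"
    with on_segment[of x] show "complex_of_real x \<in> ?T"
      by auto
  qed
qed

lemma pullbacks_on_cusp:
  assumes "-1/512 < x" "x \<le> 0"
  shows "\<exists>y<1. zw (complex_of_real x) = complex_of_real y" "\<exists>y<1. Xw (complex_of_real x) = complex_of_real y"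
proof -
  have "1728 * x / (1 + 256 * x) ^ 3 \<le> 0" "256 * x / (1 + 64 * x) ^ 2 \<le> 0"
    using assms by (auto simp: divide_nonpos_pos)
  then show "\<exists>y<1. zw (complex_of_real x) = complex_of_real y" "\<exists>y<1. Xw (complex_of_real x) = complex_of_real y"
    by (intro exI[of _ "1728 * x / (1 + 256 * x) ^ 3"] exI[of _ "256 * x / (1 + 64 * x) ^ 2"] conjI;
        simp add: zw_def Xw_def)+
qed

text \<open>On the segment \<open>(1 + 256 w) / (1 + 64 w)\<close> is positive, hence \<^const>\<open>csqrt\<close> of it is holomorphic around the
  segment. Near \<open>0\<close> this function and \<open>R\<close> are square roots of the same function close to \<open>1\<close>.\<close>

lemma rho_on_cusp:
  assumes V: "open V" "complex_of_real ` {-1/512<..0} \<subseteq> V" "R holomorphic_on V"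
    and R: "R 0 = 1" "\<forall>\<^sub>F w in at 0. R w ^ 2 = (1 + 256 * w) / (1 + 64 * w)"
    and x: "-1/512 < x" "x \<le> 0"
  shows "R (complex_of_real x) = complex_of_real (sqrt ((1 + 256 * x) / (1 + 64 * x)))"
proof -
  define f where "f w = (1 + 256 * w) / (1 + 64 * w)" for w :: complex
  let ?S = "- {-1/64 :: complex}"
  let ?T = "?S \<inter> f -` (- \<real>\<^sub>\<le>\<^sub>0)"
  have nz: "1 + 64 * w \<noteq> 0" if "w \<in> ?S" for w
    using that one_plus_mult_eq_0_iff[of 64 w] by simp
  have f: "f holomorphic_on ?S"
    unfolding f_def[abs_def] using nz by (intro holomorphic_intros) auto
  have T: "open ?T"
    by (rule continuous_open_preimage[OF holomorphic_on_imp_continuous_on[OF f]]) auto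
  have fr: "f (complex_of_real y) = complex_of_real ((1 + 256 * y) / (1 + 64 * y))" for y
    by (simp add: f_def)
  have pos: "0 < (1 + 256 * y) / (1 + 64 * y)" if "-1/512 < y" for y :: real
    using that by (intro divide_pos_pos) auto
  have hol: "(\<lambda>w. csqrt (f w)) holomorphic_on ?T"
    by (intro holomorphic_intros holomorphic_on_subset[OF f]) auto
  have inT: "complex_of_real y \<in> ?T" if "-1/512 < y" "y \<le> 0" for y
  proof -
    have "complex_of_real y \<noteq> -1/64"
    proof
      assume "complex_of_real y = -1/64"
      then have "complex_of_real y = complex_of_real (-1/64)" by simp
      then have "y = -1/64" by (simp only: of_real_eq_iff)
      with that show False by simp
    qed
    then show ?thesis using pos[OF that(1)] by (auto simp: fr simp del: of_real_divide)
  qed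
  have 0: "0 \<in> ?T" using inT[of 0] by simp
  have "0 \<in> V" using V(2) by (auto intro!: subsetD[OF V(2)] image_eqI[of _ _ 0])
  have lim: "g \<midarrow>0\<rightarrow> g 0" if "g holomorphic_on W" "open W" "0 \<in> W" for g :: "complex \<Rightarrow> complex" and W
    using holomorphic_on_imp_continuous_on[OF that(1)] that(2,3)
    by (simp add: continuous_on_eq_continuous_at isCont_def)
  have "\<forall>\<^sub>F w in at 0. R w = csqrt (f w)"
  proof (rule eq_of_square_eq_near_one)
    show "R \<midarrow>0\<rightarrow> 1" using lim[OF V(3,1) \<open>0 \<in> V\<close>] R(1) by simp
    show "(\<lambda>w. csqrt (f w)) \<midarrow>0\<rightarrow> 1" using lim[OF hol T 0] by (simp add: f_def)
    show "\<forall>\<^sub>F w in at 0. R w ^ 2 = csqrt (f w) ^ 2"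
      using R(2) by eventually_elim (simp add: f_def)
  qed
  from agree_on_cusp[OF V T hol this inT x]
  have "R (complex_of_real x) = csqrt (f (complex_of_real x))" .
  also have "\<dots> = complex_of_real (sqrt ((1 + 256 * x) / (1 + 64 * x)))"
    unfolding fr using pos[OF x(1)] by (simp only: of_real_sqrt less_imp_le)
  finally show ?thesis .
qed

lemma eventually_at_0_zt: "(\<forall>\<^sub>F w in at 0. a w = F1 (zt (inverse w))) \<longleftrightarrow> (\<forall>\<^sub>F w in at 0. a w = F1 (zw w))"
  by (rule eventually_cong[OF eventually_neq_at_within[of 0]]) (simp add: zt_inverse)

lemma eventually_at_0_Xt: "(\<forall>\<^sub>F w in at 0. b w = F2 (Xt (inverse w))) \<longleftrightarrow> (\<forall>\<^sub>F w in at 0. b w = F2 (Xw w))"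
  by (rule eventually_cong[OF eventually_neq_at_within[of 0]]) (simp add: Xt_inverse)

lemma continues_germ_chart_imageD:
  assumes "open V" "0 \<in> V" "continues_germ_at_infinity G (chart_infinity ` V) f"
  shows "(\<lambda>w. G (chart_infinity w)) holomorphic_on V"
    "\<forall>\<^sub>F w in at 0. G (chart_infinity w) = f (inverse w)"
  using assms continues_germ_chart_image by blast+

lemma hypergeometric_continues:
  assumes V: "open V" "simply_connected V" "0 \<in> V" "V \<inter> singular_points = {}"
  shows "\<exists>A. continues_germ_at_infinity A (chart_infinity ` V) (\<lambda>t. F1 (zt t))"
    "\<exists>B. continues_germ_at_infinity B (chart_infinity ` V) (\<lambda>t. F2 (Xt t))"
proof -
  from pullbacks_continue(1)[OF V] obtain A where
    "A holomorphic_on V" "\<forall>\<^sub>F w in at 0. A w = F1 (zw w)"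
    by (auto simp: eventually_nhds_conv_at)
  then show "\<exists>A. continues_germ_at_infinity A (chart_infinity ` V) (\<lambda>t. F1 (zt t))"
    by (intro continuation_from_chart[OF V(1,3)]) (simp_all add: eventually_at_0_zt)
  from pullbacks_continue(2)[OF V] obtain B where
    "B holomorphic_on V" "\<forall>\<^sub>F w in at 0. B w = F2 (Xw w)"
    by (auto simp: eventually_nhds_conv_at)
  then show "\<exists>B. continues_germ_at_infinity B (chart_infinity ` V) (\<lambda>t. F2 (Xt t))"
    by (intro continuation_from_chart[OF V(1,3)]) (simp_all add: eventually_at_0_Xt)
qed

context
  fixes \<rho> :: "complex \<Rightarrow> complex"
  assumes rho_square: "\<forall>\<^sub>F t in at_infinity. \<rho> t ^ 2 = (t + 256) / (t + 64)"
    and rho_branch: "(\<rho> \<longlongrightarrow> 1) at_infinity"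
begin

lemma rho_chart_square: "\<forall>\<^sub>F w in at 0. \<rho> (inverse w) ^ 2 = (1 + 256 * w) / (1 + 64 * w)"
proof -
  have "\<forall>\<^sub>F w in at 0. \<rho> (inverse w) ^ 2 = (inverse w + 256) / (inverse w + 64)"
    using rho_square unfolding eventually_at_infinity_inverse .
  moreover have "\<forall>\<^sub>F w in at (0::complex). w \<noteq> 0" by (rule eventually_neq_at_within)
  ultimately show ?thesis by eventually_elim (simp add: rho_square_inverse)
qed

lemma rho_chart_limit: "(\<lambda>w. \<rho> (inverse w)) \<midarrow>0\<rightarrow> 1"
  using rho_branch by (simp add: at_to_infinity filterlim_filtermap)

lemma rho_continuation:
  assumes V: "open V" "0 \<in> V" and R: "continues_germ_at_infinity R (chart_infinity ` V) \<rho>"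
  shows "R (chart_infinity 0) = 1"
    "\<forall>\<^sub>F w in at 0. R (chart_infinity w) ^ 2 = (1 + 256 * w) / (1 + 64 * w)"
proof -
  note r = continues_germ_chart_imageD[OF V R]
  have "(\<lambda>w. R (chart_infinity w)) \<midarrow>0\<rightarrow> R (chart_infinity 0)"
    using holomorphic_on_imp_continuous_on[OF r(1)] V by (simp add: continuous_on_eq_continuous_at isCont_def)
  moreover have "(\<lambda>w. R (chart_infinity w)) \<midarrow>0\<rightarrow> 1"
    using tendsto_cong[OF r(2)] rho_chart_limit by blast
  ultimately show "R (chart_infinity 0) = 1" by (rule LIM_unique)
  show "\<forall>\<^sub>F w in at 0. R (chart_infinity w) ^ 2 = (1 + 256 * w) / (1 + 64 * w)"
    using r(2) rho_chart_square by eventually_elim simp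
qed

lemma rho_continues:
  assumes V: "open V" "simply_connected V" "0 \<in> V" "V \<inter> singular_points = {}"
  shows "\<exists>R. continues_germ_at_infinity R (chart_infinity ` V) \<rho>"
proof -
  obtain R where R: "R holomorphic_on V" "R 0 = 1" "\<And>w. w \<in> V \<Longrightarrow> R w ^ 2 = (1 + 256 * w) / (1 + 64 * w)"
    using exists_rho_branch[OF V] by blast
  have "\<forall>\<^sub>F w in at 0. R w = \<rho> (inverse w)"
  proof (rule eq_of_square_eq_near_one[OF _ rho_chart_limit])
    show "R \<midarrow>0\<rightarrow> 1"
      using holomorphic_on_imp_continuous_on[OF R(1)] V(1,3) R(2)
      by (metis continuous_on_eq_continuous_at isCont_def)
    have "\<forall>\<^sub>F w in at 0. w \<in> V" using V(1,3) by (rule eventually_at_in_open')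
    with rho_chart_square show "\<forall>\<^sub>F w in at 0. R w ^ 2 = \<rho> (inverse w) ^ 2"
      by eventually_elim (simp add: R(3))
  qed
  with R(1) V show ?thesis by (intro continuation_from_chart)
qed

text \<open>The function \<open>w \<mapsto> \<rho> (1 / w)\<close> has the limit \<open>1\<close> at \<open>w = 0\<close> while its value there is the unrelated number \<open>\<rho> 0\<close>; the continuation to a
  disc supplies the germ, analytic at \<open>0\<close>, to be used in \<open>hypergeometric_germ_identity\<close>. The disc of radius \<open>1/512\<close> reaches to the nearest singular point.\<close>

lemma germ_identity_chart: "\<forall>\<^sub>F w in at 0. F1 (zw w) = \<rho> (inverse w) * F2 (Xw w)"
proof -
  define V where "V = ball (0::complex) (1/512)"
  have V: "open V" "simply_connected V" "0 \<in> V" "V \<inter> singular_points = {}"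
    by (auto simp: V_def singular_points_def norm_divide intro: convex_imp_simply_connected)
  obtain R where R: "continues_germ_at_infinity R (chart_infinity ` V) \<rho>"
    using rho_continues[OF V] by blast
  note r = continues_germ_chart_imageD[OF V(1,3) R] rho_continuation[OF V(1,3) R]
  have "\<forall>\<^sub>F w in nhds 0. F1 (zw w) = R (chart_infinity w) * F2 (Xw w)"
  proof (rule hypergeometric_germ_identity)
    show "(\<lambda>w. R (chart_infinity w)) analytic_on {0}"
      using r(1) V by (auto simp: analytic_at)
    show "\<forall>\<^sub>F w in nhds 0. R (chart_infinity w) ^ 2 = (1 + 256 * w) / (1 + 64 * w)"
      using r(3,4) by (simp add: eventually_nhds_conv_at)
  qed (fact r(3))
  then have "\<forall>\<^sub>F w in at 0. F1 (zw w) = R (chart_infinity w) * F2 (Xw w)"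
    by (simp add: eventually_nhds_conv_at)
  with r(2) show ?thesis by eventually_elim simp
qed

lemma continued_identity:
  assumes U: "admissible_region U"
    and A: "continues_germ_at_infinity A U (\<lambda>t. F1 (zt t))"
    and R: "continues_germ_at_infinity R U \<rho>"
    and B: "continues_germ_at_infinity B U (\<lambda>t. F2 (Xt t))"
    and p: "p \<in> U"
  shows "A p = R p * B p"
proof -
  obtain V where V: "U = chart_infinity ` V" "open V" "simply_connected V" "0 \<in> V" "V \<inter> singular_points = {}"
    using admissible_regionE[OF U] .
  note a = continues_germ_chart_imageD[OF V(2,4) A[unfolded V(1)], unfolded eventually_at_0_zt]
  note r = continues_germ_chart_imageD[OF V(2,4) R[unfolded V(1)]]
  note b = continues_germ_chart_imageD[OF V(2,4) B[unfolded V(1)], unfolded eventually_at_0_Xt]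
  obtain w where w: "w \<in> V" "p = chart_infinity w" using p V(1) by blast
  have "A (chart_infinity w) = R (chart_infinity w) * B (chart_infinity w)"
  proof (rule holomorphic_agree_on_connected[OF a(1) V(2) _ V(2) _ _ V(4) _ w(1)])
    show "(\<lambda>w. R (chart_infinity w) * B (chart_infinity w)) holomorphic_on V"
      by (intro holomorphic_intros r b)
    show "\<forall>\<^sub>F w in at 0. A (chart_infinity w) = R (chart_infinity w) * B (chart_infinity w)"
      using a(2) r(2) b(2) germ_identity_chart by eventually_elim simp
  qed (use simply_connected_imp_connected[OF V(3)] in auto)
  with w show ?thesis by simp
qed

lemma cusp_values:
  assumes \<Phi>1: "principal_branch F1 \<Phi>1" and \<Phi>2: "principal_branch F2 \<Phi>2"
    and U: "admissible_region U" "(\<lambda>t. Some (complex_of_real t)) ` cusp_branch \<subseteq> U"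
    and A: "continues_germ_at_infinity A U (\<lambda>t. F1 (zt t))"
    and R: "continues_germ_at_infinity R U \<rho>"
    and B: "continues_germ_at_infinity B U (\<lambda>t. F2 (Xt t))"
    and t: "t \<in> cusp_branch"
  shows "A (Some (complex_of_real t)) = \<Phi>1 (zt (complex_of_real t))"
    "R (Some (complex_of_real t)) = complex_of_real (sqrt ((t + 256) / (t + 64)))"
    "B (Some (complex_of_real t)) = \<Phi>2 (Xt (complex_of_real t))"
proof -
  obtain V where V: "U = chart_infinity ` V" "open V" "simply_connected V" "0 \<in> V" "V \<inter> singular_points = {}"
    using admissible_regionE[OF U(1)] .
  note a = continues_germ_chart_imageD[OF V(2,4) A[unfolded V(1)], unfolded eventually_at_0_zt]
  note r = continues_germ_chart_imageD[OF V(2,4) R[unfolded V(1)]] rho_continuation[OF V(2,4) R[unfolded V(1)]]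
  note b = continues_germ_chart_imageD[OF V(2,4) B[unfolded V(1)], unfolded eventually_at_0_Xt]
  have seg: "complex_of_real ` {-1/512<..0} \<subseteq> V"
  proof (intro image_subsetI)
    fix x :: real assume x: "x \<in> {-1/512<..0}"
    show "complex_of_real x \<in> V"
    proof (cases "x = 0")
      case False
      with x have "inverse x \<in> cusp_branch" by (auto simp: cusp_branch_def field_simps)
      with U(2) have "Some (complex_of_real (inverse x)) \<in> U" by blast
      also have "Some (complex_of_real (inverse x)) = chart_infinity (complex_of_real x)"
        using False by (simp add: chart_infinity_def)
      finally show ?thesis unfolding V(1) by (auto dest!: arg_cong[of _ _ chart_inverse])
    qed (use V in auto)
  qed
  define x where "x = inverse t"
  have x: "-1/512 < x" "x \<le> 0" "x \<noteq> 0" "t = inverse x"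
    using t by (auto simp: x_def cusp_branch_def field_simps)
  have c: "Some (complex_of_real t) = chart_infinity (complex_of_real x)"
    using x by (simp add: chart_infinity_def)
  let ?S1 = "- {-1/256 :: complex}" and ?S2 = "- {-1/64 :: complex}"
  have nz: "1 + 256 * w \<noteq> 0" if "w \<in> ?S1" for w
    using that one_plus_mult_eq_0_iff[of 256 w] by simp
  have nz': "1 + 64 * w \<noteq> 0" if "w \<in> ?S2" for w
    using that one_plus_mult_eq_0_iff[of 64 w] by simp
  have hol: "zw holomorphic_on ?S1" "Xw holomorphic_on ?S2"
    unfolding zw_def[abs_def] Xw_def[abs_def] using nz nz' by (intro holomorphic_intros; simp)+
  have inS: "complex_of_real y \<in> ?S1" "complex_of_real y \<in> ?S2" if "-1/512 < y" "y \<le> 0" for y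
  proof -
    have "complex_of_real y \<noteq> complex_of_real (-1/256)" "complex_of_real y \<noteq> complex_of_real (-1/64)"
      unfolding of_real_eq_iff using that by auto
    then show "complex_of_real y \<in> ?S1" "complex_of_real y \<in> ?S2" by auto
  qed
  have "A (chart_infinity (complex_of_real x)) = \<Phi>1 (zw (complex_of_real x))"
    by (rule principal_branch_pullback[OF \<Phi>1 hol(1) _ _ _ _ V(2) seg a x(1,2)])
       (use inS pullbacks_on_cusp in \<open>auto simp: zw_def\<close>)
  then show "A (Some (complex_of_real t)) = \<Phi>1 (zt (complex_of_real t))"
    using x unfolding c by (simp add: zt_inverse)
  have "B (chart_infinity (complex_of_real x)) = \<Phi>2 (Xw (complex_of_real x))"
    by (rule principal_branch_pullback[OF \<Phi>2 hol(2) _ _ _ _ V(2) seg b x(1,2)])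
       (use inS pullbacks_on_cusp in \<open>auto simp: Xw_def\<close>)
  then show "B (Some (complex_of_real t)) = \<Phi>2 (Xt (complex_of_real t))"
    using x unfolding c by (simp add: Xt_inverse)
  have "R (chart_infinity (complex_of_real x)) = complex_of_real (sqrt ((1 + 256 * x) / (1 + 64 * x)))"
    by (rule rho_on_cusp[OF V(2) seg r(1,3,4) x(1,2)])
  then show "R (Some (complex_of_real t)) = complex_of_real (sqrt ((t + 256) / (t + 64)))"
    unfolding c using rho_square_inverse[OF x(3), folded x(4)] by simp
qed

end

theorem lemma2:
  fixes \<rho> :: "complex \<Rightarrow> complex"
  assumes rho_square: "\<forall>\<^sub>F t in at_infinity. \<rho> t ^ 2 = (t + 256) / (t + 64)"
    and rho_branch: "(\<rho> \<longlongrightarrow> 1) at_infinity"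
  shows
      "(analytic_germ_at_infinity (\<lambda>t. F1 (zt t)) \<and>
        analytic_germ_at_infinity \<rho> \<and>
        analytic_germ_at_infinity (\<lambda>t. F2 (Xt t)) \<and>
        (\<forall>\<^sub>F t in at_infinity. F1 (zt t) = \<rho> t * F2 (Xt t)))
       \<and>
       (\<forall>U. admissible_region U \<longrightarrow>
         (\<exists>A. continues_germ_at_infinity A U (\<lambda>t. F1 (zt t))) \<and>
         (\<exists>R. continues_germ_at_infinity R U \<rho>) \<and>
         (\<exists>B. continues_germ_at_infinity B U (\<lambda>t. F2 (Xt t))) \<and>
         (\<forall>A R B. continues_germ_at_infinity A U (\<lambda>t. F1 (zt t)) \<and>
                  continues_germ_at_infinity R U \<rho> \<and>
                  continues_germ_at_infinity B U (\<lambda>t. F2 (Xt t)) \<longrightarrow>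
                  (\<forall>p\<in>U. A p = R p * B p)))
       \<and>
       (\<exists>U. admissible_region U \<and> (\<lambda>t. Some (complex_of_real t)) ` cusp_branch \<subseteq> U)
       \<and>
       (\<exists>\<Phi>1 \<Phi>2. principal_branch F1 \<Phi>1 \<and> principal_branch F2 \<Phi>2 \<and>
         (\<forall>U A R B. admissible_region U \<and>
            (\<lambda>t. Some (complex_of_real t)) ` cusp_branch \<subseteq> U \<and>
            continues_germ_at_infinity A U (\<lambda>t. F1 (zt t)) \<and>
            continues_germ_at_infinity R U \<rho> \<and>
            continues_germ_at_infinity B U (\<lambda>t. F2 (Xt t)) \<longrightarrow>
            (\<forall>t\<in>cusp_branch.
               A (Some (complex_of_real t)) = \<Phi>1 (zt (complex_of_real t)) \<and>
               R (Some (complex_of_real t)) = complex_of_real (sqrt ((t + 256) / (t + 64))) \<and>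
               0 < sqrt ((t + 256) / (t + 64)) \<and>
               B (Some (complex_of_real t)) = \<Phi>2 (Xt (complex_of_real t)) \<and>
               \<Phi>1 (zt (complex_of_real t)) =
                 complex_of_real (sqrt ((t + 256) / (t + 64))) * \<Phi>2 (Xt (complex_of_real t)))))"
    (is "?germ \<and> ?continuation \<and> ?region \<and> ?cusp")
proof (intro conjI)
  note rho = rho_square rho_branch
  have continues: "(\<exists>A. continues_germ_at_infinity A U (\<lambda>t. F1 (zt t))) \<and>
      (\<exists>R. continues_germ_at_infinity R U \<rho>) \<and>
      (\<exists>B. continues_germ_at_infinity B U (\<lambda>t. F2 (Xt t)))" if U: "admissible_region U" for U
  proof -
    obtain V where "U = chart_infinity ` V" "open V" "simply_connected V" "0 \<in> V" "V \<inter> singular_points = {}"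
      using admissible_regionE[OF U] .
    then show ?thesis
      using hypergeometric_continues[of V] rho_continues[OF rho, of V] by simp
  qed
  then show ?continuation
    using continued_identity[OF rho] by blast
  define V where "V = ball (0::complex) (1/512)"
  have V: "admissible_region (chart_infinity ` V)"
    by (rule admissible_region_chart_image)
       (auto simp: V_def singular_points_def norm_divide intro: convex_imp_simply_connected)
  have "Some (complex_of_real t) \<in> chart_infinity ` V" if "t \<in> cusp_branch" for t
  proof (rule image_eqI)
    show "complex_of_real (inverse t) \<in> V"
    proof -
      have t: "t < - 512" using that by (simp add: cusp_branch_def)
      have "norm (complex_of_real (inverse t)) = inverse (- t)"
        unfolding norm_of_real using t by simp
      also have "\<dots> < 1/512" using t by (simp add: field_simps)
      finally show ?thesis by (simp add: V_def)
    qed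
    show "Some (complex_of_real t) = chart_infinity (complex_of_real (inverse t))"
      using that by (auto simp: chart_infinity_def cusp_branch_def)
  qed
  with V show ?region by blast
  have "openin sphere_top (chart_infinity ` V)" "None \<in> chart_infinity ` V"
    using V by (auto simp: admissible_region_def)
  with continues[OF V]
  show "analytic_germ_at_infinity (\<lambda>t. F1 (zt t))" "analytic_germ_at_infinity \<rho>"
    "analytic_germ_at_infinity (\<lambda>t. F2 (Xt t))"
    unfolding analytic_germ_at_infinity_def by blast+
  have "\<forall>\<^sub>F w in at (0::complex). w \<noteq> 0" by (rule eventually_neq_at_within)
  with germ_identity_chart[OF rho]
  have "\<forall>\<^sub>F w in at 0. F1 (zt (inverse w)) = \<rho> (inverse w) * F2 (Xt (inverse w))"
    by eventually_elim (simp add: zt_inverse Xt_inverse)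
  then show "\<forall>\<^sub>F t in at_infinity. F1 (zt t) = \<rho> t * F2 (Xt t)"
    unfolding eventually_at_infinity_inverse .
  obtain \<Phi>1 \<Phi>2 where \<Phi>: "principal_branch F1 \<Phi>1" "principal_branch F2 \<Phi>2"
    using principal_branch_hyp unfolding F_hyp by blast
  show ?cusp
  proof (rule exI[of _ \<Phi>1], rule exI[of _ \<Phi>2], intro conjI allI impI ballI)
    fix U A R B t
    assume "admissible_region U \<and> (\<lambda>t. Some (complex_of_real t)) ` cusp_branch \<subseteq> U \<and>
        continues_germ_at_infinity A U (\<lambda>t. F1 (zt t)) \<and> continues_germ_at_infinity R U \<rho> \<and>
        continues_germ_at_infinity B U (\<lambda>t. F2 (Xt t))"
      and t: "t \<in> cusp_branch"
    then have U: "admissible_region U" "(\<lambda>t. Some (complex_of_real t)) ` cusp_branch \<subseteq> U"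
      and ARB: "continues_germ_at_infinity A U (\<lambda>t. F1 (zt t))" "continues_germ_at_infinity R U \<rho>"
        "continues_germ_at_infinity B U (\<lambda>t. F2 (Xt t))"
      by blast+
    note on_cusp = cusp_values[OF rho \<Phi> U ARB t]
    show "A (Some (complex_of_real t)) = \<Phi>1 (zt (complex_of_real t))"
      "R (Some (complex_of_real t)) = complex_of_real (sqrt ((t + 256) / (t + 64)))"
      "B (Some (complex_of_real t)) = \<Phi>2 (Xt (complex_of_real t))"
      by (fact on_cusp)+
    show "0 < sqrt ((t + 256) / (t + 64))"
      using t by (simp add: cusp_branch_def divide_neg_neg)
    have "Some (complex_of_real t) \<in> U" using U(2) t by blast
    from continued_identity[OF rho U(1) ARB this]
    show "\<Phi>1 (zt (complex_of_real t)) =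
        complex_of_real (sqrt ((t + 256) / (t + 64))) * \<Phi>2 (Xt (complex_of_real t))"
      unfolding on_cusp .
  qed (fact \<Phi>)+
qed

end
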